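(* Let $y>3$ be an integer, let $a,b,c\ge0$ be integers, and let $L=\{1^a,3^b,y^c\}$ be an admissible multiset of size $v-1$ (so $v=a+b+c+1$). Write $v=3q+r$ with $0\le r<3$. Then $L$ has a linear realization in each of the following cases: (1) $a\ge y+1$; (2) $a\ge7$ and $b\ge y-4$; (3) $a\ge4$, $a+b\ge y+1$, and $c\equiv0$ or $1\pmod y$; (4) $a\ge2$, $y=3t$ for an integer $t$, $v\ge3t+6$, and either $r$ is even and $b\ge3t$, or $r$ is odd and $b\ge3t+1$.
   Context: $K_v$ is the complete graph on vertex set $\{0,\dots,v-1\}$; the linear length of an edge $\{u,w\}$ is $|u-w|$. A multiset of size $v-1$ has a linear realization if some Hamiltonian path in $K_v$ has multiset of linear edge lengths equal to it. $\{x_1^{a_1},\dots\}$ denotes the multiset with $x_i$ of multiplicity $a_i$; $\mathrm{supp}(L)$ is the set of distinct elements. A multiset $L$ of size $v-1$ is admissible if $\mathrm{supp}(L)\subseteq\{1,\dots,\lfloor v/2\rfloor\}$ and for every divisor $d$ of $v$ the number of elements of $L$ (counted with multiplicity) divisible by $d$ is at most $v-d$. *)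

theory Defs
  imports Main "HOL-Library.Multiset"
begin

definition complete_graph :: "nat \<Rightarrow> nat set set" where
  "complete_graph v = {{u, w} | u w. u \<in> {0..<v} \<and> w \<in> {0..<v} \<and> u \<noteq> w}"

definition hamiltonian_path :: "'a set \<Rightarrow> 'a set set \<Rightarrow> 'a list \<Rightarrow> bool" where
  "hamiltonian_path V E p \<longleftrightarrow>
     distinct p \<and> set p = V \<and> successively (\<lambda>u w. {u, w} \<in> E) p"

definition linear_length :: "nat \<Rightarrow> nat \<Rightarrow> nat" where
  "linear_length u w = nat \<bar>int u - int w\<bar>"

text \<open>
  Pairing a path with its own tail (\<open>zip\<close> drops the surplus last vertex) lists
  its edges in order, as pairs of consecutive vertices.
\<close>

definition path_lengths :: "nat list \<Rightarrow> nat multiset" where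
  "path_lengths p = mset (map (\<lambda>(u, w). linear_length u w) (zip p (tl p)))"

definition has_linear_realization :: "nat \<Rightarrow> nat multiset \<Rightarrow> bool" where
  "has_linear_realization v L \<longleftrightarrow>
     (\<exists>p. hamiltonian_path {0..<v} (complete_graph v) p \<and> path_lengths p = L)"

text \<open>
  The first conjunct says that \<open>L\<close> has size \<open>v - 1\<close> and forces \<open>v \<ge> 1\<close>; hence every
  divisor \<open>d\<close> of \<open>v\<close> satisfies \<open>1 \<le> d \<le> v\<close>, so \<open>v - d\<close> does not truncate.
\<close>

definition admissible :: "nat \<Rightarrow> nat multiset \<Rightarrow> bool" where
  "admissible v L \<longleftrightarrow>
     v = size L + 1 \<and>
     set_mset L \<subseteq> {1..v div 2} \<and>
     (\<forall>d. d dvd v \<longrightarrow> size {#x \<in># L. d dvd x#} \<le> v - d)"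

end

theory Submission
  imports Defs
begin

text \<open>
  Call a Hamiltonian path of \<open>{0..<v}\<close> that starts at \<open>0\<close> standard. Two standard paths can be
  glued at \<open>0\<close> after reflecting one of them, so it suffices to realize a part of the multiset that
  contains all lengths \<open>y\<close> by a standard path and to leave \<open>{1^a', 3^b'}\<close> with \<open>a' \<ge> 2\<close> or
  \<open>b' = 0\<close>, which is realized by running through the three residue classes modulo 3.

  For the part with the lengths \<open>y\<close>, write the vertices in rows of \<open>y\<close>. A path traverses whole
  columns, alternately up and down, and changes columns by steps 1 and 3 along the bottom row or
  along the tops. The last row may be incomplete, so that the columns below some \<open>R\<close> have one vertex
  more than the others. Between the two kinds of columns one can change at the bottom, but at the
  top only from column \<open>0\<close> around the border to one of the last columns. If \<open>R\<close> is even, take the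
  columns from left to right. If \<open>y - R\<close> is odd, take column \<open>0\<close> first and the others from
  right to left. If neither applies, add a vertex, so that \<open>R\<close> becomes even, and turn back
  inside the last but one column, which exchanges one length \<open>y\<close> for a length 1 or 3.

  If \<open>y = 3t\<close>, a length \<open>y\<close> is a length \<open>t\<close> inside a residue class modulo 3. Two copies of one
  path with lengths 1 and \<open>t\<close> and a third such path, on one residue class each, are linked by
  two steps 1.
\<close>

section \<open>Hamiltonian paths on sets of vertices\<close>

lemma linear_length_commute: "linear_length u w = linear_length w u"
  by (simp add: linear_length_def abs_minus_commute)

lemma linear_length_add_left: "linear_length (k + u) (k + w) = linear_length u w"
  by (simp add: linear_length_def)

lemma path_lengths_Nil [simp]: "path_lengths [] = {#}"
  by (simp add: path_lengths_def)

lemma path_lengths_singleton [simp]: "path_lengths [x] = {#}"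
  by (simp add: path_lengths_def)

lemma path_lengths_Cons:
  "xs \<noteq> [] \<Longrightarrow> path_lengths (x # xs) = add_mset (linear_length x (hd xs)) (path_lengths xs)"
  by (cases xs) (simp_all add: path_lengths_def)

lemma path_lengths_append:
  "xs \<noteq> [] \<Longrightarrow> ys \<noteq> [] \<Longrightarrow>
    path_lengths (xs @ ys) = path_lengths xs + path_lengths ys + {#linear_length (last xs) (hd ys)#}"
proof (induction xs)
  case (Cons x xs)
  then show ?case by (cases "xs = []") (simp_all add: path_lengths_Cons)
qed simp

lemma path_lengths_rev: "path_lengths (rev xs) = path_lengths xs"
proof (induction xs)
  case (Cons x xs)
  then show ?case
    by (cases "xs = []")
      (simp_all add: path_lengths_append path_lengths_Cons last_rev linear_length_commute)
qed simp

lemma path_lengths_map: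
  assumes "\<And>x y. x \<in> set xs \<Longrightarrow> y \<in> set xs \<Longrightarrow> linear_length (f x) (f y) = g (linear_length x y)"
  shows "path_lengths (map f xs) = image_mset g (path_lengths xs)"
  using assms
proof (induction xs)
  case (Cons x xs)
  then show ?case by (cases "xs = []") (simp_all add: path_lengths_Cons hd_map)
qed simp

text \<open>The vertex set is arbitrary since the pieces to be joined are columns or residue classes
  rather than intervals. Both ends are recorded because they determine the linking length of a
  join.\<close>

definition ham_path :: "nat set \<Rightarrow> nat \<Rightarrow> nat \<Rightarrow> nat multiset \<Rightarrow> bool" where
  "ham_path V u w M \<longleftrightarrow>
     (\<exists>p. p \<noteq> [] \<and> distinct p \<and> set p = V \<and> hd p = u \<and> last p = w \<and> path_lengths p = M)"

lemma ham_in: assumes "ham_path V u w M" shows "u \<in> V"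
  using assms unfolding ham_path_def by auto

lemma ham_singleton: "ham_path {x} x x {#}"
  unfolding ham_path_def by (intro exI[of _ "[x]"]) simp

lemma ham_rev: "ham_path V u w M \<Longrightarrow> ham_path V w u M"
  unfolding ham_path_def
proof (elim exE conjE)
  fix p assume "p \<noteq> []" "distinct p" "set p = V" "hd p = u" "last p = w" "path_lengths p = M"
  then show "\<exists>p. p \<noteq> [] \<and> distinct p \<and> set p = V \<and> hd p = w \<and> last p = u \<and> path_lengths p = M"
    by (intro exI[of _ "rev p"]) (simp add: path_lengths_rev hd_rev last_rev)
qed

lemma ham_join:
  assumes "ham_path V u w M" "ham_path W u' w' N" "V \<inter> W = {}"
    and "U = V \<union> W" "K = M + N + {#linear_length w u'#}"
  shows "ham_path U u w' K"
proof -
  obtain p q where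
    "p \<noteq> []" "distinct p" "set p = V" "hd p = u" "last p = w" "path_lengths p = M"
    "q \<noteq> []" "distinct q" "set q = W" "hd q = u'" "last q = w'" "path_lengths q = N"
    using assms(1,2) unfolding ham_path_def by blast
  then show ?thesis
    unfolding ham_path_def using assms(3-5)
    by (intro exI[of _ "p @ q"]) (simp add: path_lengths_append)
qed

text \<open>One rule for all embeddings that change every length by the same function
  \<open>g\<close>: the identity for shifts and reflections, a multiplication for residue
  classes.\<close>

lemma ham_map:
  assumes "ham_path V u w M" "inj_on f V"
    and "\<And>x y. x \<in> V \<Longrightarrow> y \<in> V \<Longrightarrow> linear_length (f x) (f y) = g (linear_length x y)"
    and "U = f ` V" "u' = f u" "w' = f w" "K = image_mset g M"
  shows "ham_path U u' w' K"
proof -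
  obtain p where p: "p \<noteq> []" "distinct p" "set p = V" "hd p = u" "last p = w" "path_lengths p = M"
    using assms(1) unfolding ham_path_def by blast
  have "path_lengths (map f p) = image_mset g (path_lengths p)"
    by (rule path_lengths_map) (use assms(3) p(3) in auto)
  then show ?thesis
    unfolding ham_path_def using assms(2,4-7) p
    by (intro exI[of _ "map f p"]) (auto simp: distinct_map hd_map last_map)
qed

lemma ham_shift:
  assumes "ham_path V u w M" "U = (+) k ` V" "u' = k + u" "w' = k + w"
  shows "ham_path U u' w' M"
  by (rule ham_map[OF assms(1), where f = "(+) k" and g = id])
    (use assms in \<open>auto simp: linear_length_add_left\<close>)

lemma ham_reflect:
  assumes "ham_path V u w M" "V \<subseteq> {..N}" "U = (-) N ` V" "u' = N - u" "w' = N - w"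
  shows "ham_path U u' w' M"
proof (rule ham_map[OF assms(1), where f = "(-) N" and g = id])
  show "inj_on ((-) N) V"
  proof (rule inj_onI)
    fix x y assume "x \<in> V" "y \<in> V" "N - x = N - y"
    moreover from this have "x \<le> N" "y \<le> N" using assms(2) by auto
    ultimately show "x = y" by simp
  qed
  show "linear_length (N - x) (N - y) = id (linear_length x y)" if "x \<in> V" "y \<in> V" for x y
    using that assms(2) by (auto simp: linear_length_def subset_iff of_nat_diff)
qed (use assms in auto)

lemma reflect_interval:
  assumes "b \<le> Suc N"
  shows "(-) N ` {a..<b} = {Suc N - b..<Suc N - a}"
proof (intro set_eqI iffI)
  fix x assume "x \<in> {Suc N - b..<Suc N - a}"
  then show "x \<in> (-) N ` {a..<b}"
    using assms by (intro image_eqI[of _ _ "N - x"]) auto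
qed (use assms in auto)

lemma ham_scale:
  assumes "ham_path V u w M" "0 < m" "U = (\<lambda>i. m * i + j) ` V" "u' = m * u + j" "w' = m * w + j"
    "K = image_mset ((*) m) M"
  shows "ham_path U u' w' K"
proof (rule ham_map[OF assms(1), where f = "\<lambda>i. m * i + j" and g = "(*) m"])
  show "inj_on (\<lambda>i. m * i + j) V"
    using assms(2) by (auto simp: inj_on_def)
  show "linear_length (m * x + j) (m * y + j) = m * linear_length x y" for x y
  proof -
    have "int (m * x + j) - int (m * y + j) = int m * (int x - int y)"
      by (simp add: algebra_simps)
    then have "\<bar>int (m * x + j) - int (m * y + j)\<bar> = int m * \<bar>int x - int y\<bar>"
      by (simp add: abs_mult)
    then show ?thesis
      by (simp add: linear_length_def nat_mult_distrib)
  qed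
qed (use assms in auto)

text \<open>In a complete graph distinct vertices are adjacent, so only distinctness of the list has
  to be checked.\<close>

lemma has_linear_realization_iff:
  "has_linear_realization v L \<longleftrightarrow> (\<exists>p. distinct p \<and> set p = {..<v} \<and> path_lengths p = L)"
proof -
  have "hamiltonian_path {0..<v} (complete_graph v) p"
    if "distinct p" "set p = {..<v}" for p
  proof -
    have "successively (\<lambda>u w. {u, w} \<in> complete_graph v) q"
      if "distinct q" "set q \<subseteq> {..<v}" for q
      using that
    proof (induction q rule: induct_list012)
      case (3 x y zs)
      then have "{x, y} \<in> complete_graph v"
        unfolding complete_graph_def by fastforce
      with 3 show ?case by simp
    qed auto
    with that show ?thesis
      unfolding hamiltonian_path_def by auto
  qed
  then show ?thesis
    unfolding has_linear_realization_def hamiltonian_path_def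
    by (metis atLeast0LessThan)
qed

section \<open>Standard paths and gluing them at a common vertex\<close>

definition standard :: "nat \<Rightarrow> nat multiset \<Rightarrow> bool" where
  "standard n M \<longleftrightarrow> (\<exists>w. ham_path {..<n} 0 w M)"

lemma standard_imp_realization: "standard n M \<Longrightarrow> has_linear_realization n M"
  unfolding standard_def ham_path_def has_linear_realization_iff by blast

lemma standard_join:
  assumes "standard (Suc m) M" "standard (Suc n) N" "v = Suc (m + n)" "L = M + N"
  shows "has_linear_realization v L"
proof -
  obtain z where z: "ham_path {..<Suc m} 0 z M"
    using assms(1) unfolding standard_def by blast
  \<comment> \<open>Reflection moves the end \<open>0\<close> of the first path to \<open>m\<close>,
    where the shifted second path starts.\<close>
  have *: "ham_path {..m} (m - z) m M"
  proof (rule ham_rev, rule ham_reflect[OF z, of m])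
    show "{..m} = (-) m ` {..<Suc m}"
      using reflect_interval[of "Suc m" m 0] by (simp add: lessThan_atLeast0 flip: lessThan_Suc_atMost)
  qed auto
  then obtain p where p: "p \<noteq> []" "distinct p" "set p = {..m}" "last p = m" "path_lengths p = M"
    unfolding ham_path_def by blast
  obtain q where q: "q \<noteq> []" "distinct q" "set q = {..<Suc n}" "hd q = 0" "path_lengths q = N"
    using assms(2) unfolding standard_def ham_path_def by blast
  define q' where "q' = map ((+) m) q"
  have q': "q' \<noteq> []" "distinct q'" "set q' = {m..<Suc (m + n)}" "hd q' = m" "path_lengths q' = N"
  proof -
    show "set q' = {m..<Suc (m + n)}"
      unfolding q'_def using q(3) by (simp add: lessThan_atLeast0 image_add_atLeastLessThan add.commute)
    show "path_lengths q' = N"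
      using path_lengths_map[of q "(+) m" id] q(5) by (simp add: q'_def linear_length_add_left)
  qed (use q in \<open>auto simp: q'_def distinct_map hd_map\<close>)
  obtain qs where qs: "q' = m # qs"
    using q'(1,4) by (cases q') auto
  have set_qs: "set qs = {Suc m..<Suc (m + n)}"
  proof -
    have "m \<notin> set qs" "insert m (set qs) = {m..<Suc (m + n)}"
      using q'(2,3) unfolding qs by auto
    moreover have "{m..<Suc (m + n)} = insert m {Suc m..<Suc (m + n)}" by auto
    ultimately show ?thesis
      by (metis Suc_n_not_le_n atLeastLessThan_iff insert_ident)
  qed
  \<comment> \<open>The common vertex \<open>m\<close> is kept only in \<open>p\<close>; the edge
    from \<open>last p = m\<close> to \<open>hd qs\<close> is then the first edge of
    \<open>q'\<close>, so no length is added. For \<open>qs = []\<close> there is no such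
    edge.\<close>
  have "path_lengths (p @ qs) = M + N"
  proof (cases "qs = []")
    case True
    then show ?thesis using p q'(5) qs by auto
  next
    case False
    then show ?thesis
      using p q'(5) qs by (auto simp: path_lengths_append path_lengths_Cons)
  qed
  moreover have "distinct (p @ qs)" "set (p @ qs) = {..<v}"
    using p q'(2) qs set_qs assms(3) by auto
  ultimately show ?thesis
    unfolding has_linear_realization_iff using assms(4) by blast
qed

text \<open>Shift the path up by 1 and put \<open>0\<close> in front: the new edge joins
  \<open>0\<close> to \<open>1\<close>.\<close>

lemma standard_prefix:
  assumes "standard n M" "L = M + replicate_mset k 1" "m = n + k"
  shows "standard m L"
proof -
  have "standard (n + k) (M + replicate_mset k 1)"
  proof (induction k)
    case (Suc k)
    obtain w where w: "ham_path {..<n + k} 0 w (M + replicate_mset k 1)"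
      using Suc.IH unfolding standard_def by blast
    have "ham_path {1..<n + Suc k} 1 (Suc w) (M + replicate_mset k 1)"
      by (rule ham_shift[OF w, of _ 1]) (auto simp: lessThan_atLeast0 image_Suc_atLeastLessThan)
    then have "ham_path {..<n + Suc k} 0 (Suc w) (M + replicate_mset (Suc k) 1)"
      by (rule ham_join[OF ham_singleton[of 0]]) (auto simp: linear_length_def)
    then show ?case unfolding standard_def by blast
  qed (use assms(1) in simp)
  then show ?thesis using assms(2,3) by simp
qed

section \<open>Traversing the columns of a grid\<close>

lemma replicate_mset_plus: "replicate_mset (m + n) x = replicate_mset m x + replicate_mset n x"
  by (rule multiset_eqI) simp

definition len_mset :: "nat \<Rightarrow> nat \<Rightarrow> nat \<Rightarrow> nat \<Rightarrow> nat multiset" where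
  "len_mset y a b c = replicate_mset a 1 + replicate_mset b 3 + replicate_mset c y"

lemma len_mset_cong: "a = a' \<Longrightarrow> b = b' \<Longrightarrow> c = c' \<Longrightarrow> len_mset y a b c = len_mset y a' b' c'"
  by simp

lemma len_mset_add: "len_mset y a b c + len_mset y a' b' c' = len_mset y (a + a') (b + b') (c + c')"
  by (simp add: len_mset_def replicate_mset_plus ac_simps)

text \<open>With every summand written as a \<open>len_mset\<close>, an equation between multisets
  of lengths becomes three equations of natural numbers.\<close>

lemma len_mset_single: "{#1#} = len_mset y 1 0 0" "{#3#} = len_mset y 0 1 0" "{#y#} = len_mset y 0 0 1"
  "{#} = len_mset y 0 0 0" "replicate_mset n y = len_mset y 0 0 n"
  by (simp_all add: len_mset_def)

lemma set_mset_len_mset: "x \<in># len_mset y a b 0 \<Longrightarrow> x = 1 \<or> x = 3"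
  by (auto simp: len_mset_def split: if_splits)

lemma ham_run: "ham_path {..h} 0 h (replicate_mset h 1)"
proof (induction h)
  case 0
  show ?case using ham_singleton[of 0] by simp
next
  case (Suc h)
  then show ?case
    by (rule ham_join[OF _ ham_singleton[of "Suc h"]]) (auto simp: linear_length_def)
qed

text \<open>\<open>S\<close> is a set of columns and \<open>h\<close> counts rows, so the top row of
  height \<open>Suc h\<close> has index \<open>h\<close>.\<close>

definition grid :: "nat \<Rightarrow> nat set \<Rightarrow> nat \<Rightarrow> nat set" where
  "grid y S h = {x. x mod y \<in> S \<and> x div y < h}"

lemma grid_Un: "grid y (S \<union> T) h = grid y S h \<union> grid y T h"
  by (auto simp: grid_def)

lemma grid_disjoint: "S \<inter> T = {} \<Longrightarrow> grid y S h \<inter> grid y T h' = {}"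
  by (auto simp: grid_def)

text \<open>The incomplete row \<open>Q\<close> meets exactly the columns below \<open>R\<close>,
  which are therefore taller by one.\<close>

lemma grid_full:
  assumes "R \<le> y" "0 < y"
  shows "{..<y * Q + R} = grid y {..<R} (Suc Q) \<union> grid y {R..<y} Q"
proof (intro set_eqI)
  fix x
  have x: "x = y * (x div y) + x mod y" by simp
  have m: "x mod y < y" using assms(2) by simp
  consider "x div y < Q" | "x div y = Q" | "x div y > Q" by linarith
  then show "x \<in> {..<y * Q + R} \<longleftrightarrow> x \<in> grid y {..<R} (Suc Q) \<union> grid y {R..<y} Q"
  proof cases
    case 1
    then have "y * Suc (x div y) \<le> y * Q" by (intro mult_le_mono2) simp
    then have "x < y * Q + R" using x m unfolding mult_Suc_right by linarith
    then show ?thesis using 1 m by (auto simp: grid_def)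
  next
    case 2
    then have "x < y * Q + R \<longleftrightarrow> x mod y < R" using x by (metis nat_add_left_cancel_less)
    then show ?thesis using 2 m by (auto simp: grid_def)
  next
    case 3
    then have "y * Suc Q \<le> y * (x div y)" by (intro mult_le_mono2) simp
    then have "\<not> x < y * Q + R" using x assms(1) unfolding mult_Suc_right by linarith
    then show ?thesis using 3 by (auto simp: grid_def)
  qed
qed

lemma ham_column:
  assumes "c < y"
  shows "ham_path (grid y {c} (Suc h)) c (y * h + c) (replicate_mset h y)"
proof (rule ham_scale[OF ham_run[of h], of y _ c])
  show "grid y {c} (Suc h) = (\<lambda>i. y * i + c) ` {..h}"
  proof (intro set_eqI iffI)
    fix x assume "x \<in> grid y {c} (Suc h)"
    then show "x \<in> (\<lambda>i. y * i + c) ` {..h}"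
      by (intro image_eqI[of _ _ "x div y"]) (auto simp: grid_def)
  qed (use assms in \<open>auto simp: grid_def\<close>)
qed (use assms in auto)

text \<open>Changes of column stay within one row and so keep the lengths of \<open>M\<close>; each
  column adds \<open>h\<close> lengths \<open>y\<close>. The direction alternates, so the parity of
  the number of columns decides between bottom and top at the end.\<close>

lemma ham_snake:
  assumes "ham_path S u w M" "S \<subseteq> {..<y}"
  shows ham_snake_up: "ham_path (grid y S (Suc h)) u (if even (card S) then w else y * h + w)
      (M + replicate_mset (card S * h) y)" (is "?up")
    and ham_snake_down: "ham_path (grid y S (Suc h)) (y * h + u)
      (if even (card S) then y * h + w else w)
      (M + replicate_mset (card S * h) y)" (is "?down")
proof -
  \<comment> \<open>Both directions are proved together: after a first column taken upwards the
    remaining ones are entered at the top, and conversely.\<close>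
  have *: "ham_path (grid y (set p) (Suc h)) (hd p) (if even (length p) then last p else y * h + last p)
      (path_lengths p + replicate_mset (length p * h) y) \<and>
    ham_path (grid y (set p) (Suc h)) (y * h + hd p)
      (if even (length p) then y * h + last p else last p)
      (path_lengths p + replicate_mset (length p * h) y)"
    if "p \<noteq> []" "distinct p" "set p \<subseteq> {..<y}" for p
    using that
  proof (induction p)
    case (Cons c p)
    have c: "c < y" using Cons.prems by simp
    note col = ham_column[OF c, of h]
    show ?case
    proof (cases "p = []")
      case True
      then show ?thesis using col ham_rev[OF col] by simp
    next
      case False
      with Cons.IH Cons.prems
      have IH: "ham_path (grid y (set p) (Suc h)) (hd p) (if even (length p) then last p else y * h + last p)
          (path_lengths p + replicate_mset (length p * h) y)"
        "ham_path (grid y (set p) (Suc h)) (y * h + hd p)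
          (if even (length p) then y * h + last p else last p)
          (path_lengths p + replicate_mset (length p * h) y)"
        by auto
      have disj: "grid y {c} (Suc h) \<inter> grid y (set p) (Suc h) = {}"
        using Cons.prems by (intro grid_disjoint) auto
      have un: "grid y (set (c # p)) (Suc h) = grid y {c} (Suc h) \<union> grid y (set p) (Suc h)"
        by (simp flip: grid_Un)
      have M: "path_lengths (c # p) + replicate_mset (length (c # p) * h) y =
         replicate_mset h y + (path_lengths p + replicate_mset (length p * h) y) +
          {#linear_length c (hd p)#}"
        using False by (simp add: path_lengths_Cons replicate_mset_plus)
      show ?thesis
        using ham_join[OF col IH(2) disj un, unfolded linear_length_add_left, OF M]
          ham_join[OF ham_rev[OF col] IH(1) disj un M] False
        by (cases "even (length p)") simp_all
    qed
  qed simp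
  obtain p where "p \<noteq> []" "distinct p" "set p = S" "hd p = u" "last p = w" "path_lengths p = M"
    using assms(1) unfolding ham_path_def by blast
  with *[of p] assms(2) show ?up ?down
    by (auto simp: distinct_card[symmetric])
qed

lemma grid_Suc: "c < y \<Longrightarrow> grid y {c} (Suc h) = insert (y * h + c) (grid y {c} h)"
proof (intro set_eqI)
  fix x assume "c < y"
  moreover have "x = y * h + c" if "x mod y = c" "x div y = h"
    using that by (metis mult_div_mod_eq)
  ultimately show "x \<in> grid y {c} (Suc h) \<longleftrightarrow> x \<in> insert (y * h + c) (grid y {c} h)"
    by (auto simp: grid_def less_Suc_eq)
qed

text \<open>
  After an odd number of whole columns the snake visits the top of \<open>e\<close>, crosses over to \<open>b\<close>,
  descends, and returns through \<open>e\<close> from below.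
\<close>

lemma ham_snake_turn:
  assumes "ham_path S u e M" "even (card S)" "b \<notin> S" "S \<union> {b} \<subseteq> {..<y}"
    and "T = S \<union> {b}" "d = linear_length e b"
    and "K = M + {#d, d#} + replicate_mset (card S * Suc h + h) y"
  shows "\<exists>w. ham_path (grid y T (Suc (Suc h))) u w K"
proof -
  obtain p where p: "p \<noteq> []" "distinct p" "set p = S" "hd p = u" "last p = e" "path_lengths p = M"
    using assms(1) unfolding ham_path_def by blast
  have card: "card S = length p" using p(2,3) distinct_card by metis
  obtain s where s: "p = s @ [e]" using p(1,5) by (metis append_butlast_last_id)
  have "s \<noteq> []" using s assms(2) card by auto
  have e: "e < y" "b < y" "e \<noteq> b" using assms(3,4) p(3) s by auto
  have top: "(y * Suc h + e) mod y = e" using e by (metis mod_mult_self4 mod_less)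
  \<comment> \<open>\<open>s\<close> has an odd number of columns, so the snake over it ends in the
    top row \<open>Suc h\<close>, from where the top of \<open>e\<close> is reached.\<close>
  have "ham_path (set s) u (last s) (path_lengths s)"
    unfolding ham_path_def using \<open>s \<noteq> []\<close> s p by (intro exI[of _ s]) auto
  from ham_snake_up[OF this, of y "Suc h"]
  have 1: "ham_path (grid y (set s) (Suc (Suc h))) u (y * (Suc h) + last s)
      (path_lengths s + replicate_mset (length s * Suc h) y)"
    using s p(2,3) assms(2,4) card by (auto simp: distinct_card)
  have "ham_path (grid y (set s) (Suc (Suc h)) \<union> {y * (Suc h) + e}) u (y * (Suc h) + e)
      (M + replicate_mset (length s * Suc h) y)"
  proof (rule ham_join[OF 1 ham_singleton _ refl])
    show "grid y (set s) (Suc (Suc h)) \<inter> {y * (Suc h) + e} = {}"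
    proof -
      have "y * Suc h + e \<notin> grid y (set s) (Suc (Suc h))"
        using s p(2) top unfolding grid_def by simp
      then show ?thesis by blast
    qed
    show "M + replicate_mset (length s * Suc h) y =
      path_lengths s + replicate_mset (length s * Suc h) y + {#} +
      {#linear_length (y * (Suc h) + last s) (y * (Suc h) + e)#}"
      using p(6) s \<open>s \<noteq> []\<close> unfolding linear_length_add_left by (simp add: path_lengths_append)
  qed
  moreover have "ham_path (grid y {b} (Suc (Suc h))) (y * (Suc h) + b) b (replicate_mset (Suc h) y)"
    using ham_rev[OF ham_column[OF e(2), of "Suc h"]] by simp
  ultimately have "ham_path (grid y (set s) (Suc (Suc h)) \<union> {y * (Suc h) + e} \<union> grid y {b} (Suc (Suc h))) u b
     (M + replicate_mset (length s * Suc h) y + replicate_mset (Suc h) y + {#d#})"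
  proof (rule ham_join[OF _ _ _ refl])
    show "(grid y (set s) (Suc (Suc h)) \<union> {y * (Suc h) + e}) \<inter> grid y {b} (Suc (Suc h)) = {}"
      using assms(3) p(3) s e top by (auto simp: grid_def simp del: mult_Suc_right)
  qed (use assms(6) in \<open>simp only: linear_length_add_left\<close>)
  then have "ham_path (grid y T (Suc (Suc h))) u (y * h + e) K"
  proof (rule ham_join)
    \<comment> \<open>The top of \<open>e\<close> has been visited already; the rows up to
      \<open>h\<close> remain, with \<open>h\<close> lengths \<open>y\<close> instead of
      \<open>Suc h\<close>.\<close>
    show "ham_path (grid y {e} (Suc h)) e (y * h + e) (replicate_mset h y)"
      using ham_column[OF e(1), of h] by simp
    show "(grid y (set s) (Suc (Suc h)) \<union> {y * (Suc h) + e} \<union> grid y {b} (Suc (Suc h))) \<inter> grid y {e} (Suc h) = {}"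
    proof -
      have "y * Suc h + e \<notin> grid y {e} (Suc h)"
        using e by (auto simp: grid_def simp del: mult_Suc_right)
      then show ?thesis using s p(2) e by (auto simp: grid_def simp del: mult_Suc_right)
    qed
    have T: "T = set s \<union> {e} \<union> {b}" using assms(5) p(3) s by auto
    have g: "grid y {e} (Suc (Suc h)) = insert (y * (Suc h) + e) (grid y {e} (Suc h))"
      using grid_Suc[OF e(1), of "Suc h"] by simp
    show "grid y T (Suc (Suc h)) =
        grid y (set s) (Suc (Suc h)) \<union> {y * (Suc h) + e} \<union> grid y {b} (Suc (Suc h)) \<union> grid y {e} (Suc h)"
      unfolding T grid_Un g by blast
    show "K = M + replicate_mset (length s * Suc h) y + replicate_mset (Suc h) y + {#d#} +
        replicate_mset h y + {#linear_length b e#}"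
      using assms(6,7) card s by (simp add: linear_length_commute replicate_mset_plus)
  qed
  then show ?thesis by blast
qed

text \<open>Apply the turn with the last column as \<open>b\<close> and the last but one as
  \<open>e\<close>. Compared with the plain snake, one length \<open>y\<close> is exchanged for a
  second copy of the last column change \<open>d\<close>. Only its membership in \<open>M\<close> is
  recorded, which suffices to know that it is 1 or 3.\<close>

lemma ham_snake_turn_last:
  assumes "ham_path S u w M" "odd (card S)" "2 \<le> card S" "S \<subseteq> {..<y}"
  shows "\<exists>d\<in>#M. \<exists>z. ham_path (grid y S (Suc (Suc h))) u z
    (M + {#d#} + replicate_mset ((card S - 1) * Suc h + h) y)"
proof -
  obtain p where p: "p \<noteq> []" "distinct p" "set p = S" "hd p = u" "last p = w" "path_lengths p = M"
    using assms(1) unfolding ham_path_def by blast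
  have card: "card S = length p" using p(2,3) distinct_card by metis
  obtain s where s: "p = s @ [w]" using p(1,5) by (metis append_butlast_last_id)
  have "s \<noteq> []" using s assms(3) card by auto
  have M: "M = path_lengths s + {#linear_length (last s) w#}"
    using p(6) s \<open>s \<noteq> []\<close> by (simp add: path_lengths_append)
  have "ham_path (set s) u (last s) (path_lengths s)"
    unfolding ham_path_def using \<open>s \<noteq> []\<close> s p by (intro exI[of _ s]) auto
  moreover have card_s: "card (set s) = card S - 1"
    using s p(2) card by (simp add: distinct_card)
  moreover have S: "S = set s \<union> {w}" "w \<notin> set s"
    using s p(2,3) by auto
  ultimately have "\<exists>z. ham_path (grid y S (Suc (Suc h))) u z
    (path_lengths s + {#linear_length (last s) w, linear_length (last s) w#} +
     replicate_mset (card (set s) * Suc h + h) y)"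
    using assms(2,4) by (intro ham_snake_turn[of "set s" u "last s" "path_lengths s" w]) auto
  then have "\<exists>z. ham_path (grid y S (Suc (Suc h))) u z
    (M + {#linear_length (last s) w#} + replicate_mset ((card S - 1) * Suc h + h) y)"
    unfolding M card_s by simp
  moreover have "linear_length (last s) w \<in># M" unfolding M by simp
  ultimately show ?thesis by (rule bexI)
qed

section \<open>Paths with lengths 1 and 3\<close>

lemma thirds:
  "n = 3 * k \<Longrightarrow> {..<n} = grid 3 {0} k \<union> grid 3 {1} k \<union> grid 3 {2} k"
  "n = 3 * k + 1 \<Longrightarrow> {..<n} = grid 3 {0} (Suc k) \<union> grid 3 {1} k \<union> grid 3 {2} k"
  "n = 3 * k + 2 \<Longrightarrow> {..<n} = grid 3 {0} (Suc k) \<union> grid 3 {1} (Suc k) \<union> grid 3 {2} k"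
proof -
  have *: "{..<1::nat} = {0}" "{..<2::nat} = {0} \<union> {1}" "{0..<3::nat} = {0} \<union> {1} \<union> {2}"
    "{1..<3::nat} = {1} \<union> {2}" "{2..<3::nat} = {2}"
    by auto
  have "grid 3 {..<0} (Suc k) = {}" by (simp add: grid_def)
  then show "n = 3 * k \<Longrightarrow> {..<n} = grid 3 {0} k \<union> grid 3 {1} k \<union> grid 3 {2} k"
    using grid_full[of 0 3 k] unfolding * grid_Un by simp
  show "n = 3 * k + 1 \<Longrightarrow> {..<n} = grid 3 {0} (Suc k) \<union> grid 3 {1} k \<union> grid 3 {2} k"
    using grid_full[of 1 3 k] unfolding * grid_Un by (simp add: Un_assoc)
  show "n = 3 * k + 2 \<Longrightarrow> {..<n} = grid 3 {0} (Suc k) \<union> grid 3 {1} (Suc k) \<union> grid 3 {2} k"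
    using grid_full[of 2 3 k] unfolding * grid_Un by simp
qed

text \<open>Go up the class \<open>i\<close>, step to the neighbouring top of \<open>j\<close>, go
  down, step to the bottom of \<open>l\<close> and go up again. The two steps between classes are
  the only ones.\<close>

lemma ham_three_tracks:
  assumes "i < 3" "j < 3" "l < 3" "i \<noteq> j" "j \<noteq> l" "i \<noteq> l"
    and "linear_length (3 * a + i) (3 * b + j) = 1" "linear_length j l = 1"
    and "V = grid 3 {i} (Suc a) \<union> grid 3 {j} (Suc b) \<union> grid 3 {l} (Suc c)"
    and "w = 3 * c + l" "M = len_mset y 2 (a + b + c) 0"
  shows "ham_path V i w M"
proof -
  have "ham_path (grid 3 {i} (Suc a) \<union> grid 3 {j} (Suc b)) i j
      (replicate_mset a 3 + replicate_mset b 3 + {#1#})"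
  proof (rule ham_join[OF ham_column[OF assms(1)] ham_rev[OF ham_column[OF assms(2)]] _ refl])
    show "replicate_mset a 3 + replicate_mset b 3 + {#1#} = replicate_mset a 3 + replicate_mset b 3 +
        {#linear_length (3 * a + i) (3 * b + j)#}"
      unfolding assms(7) ..
  qed (use assms(4) in \<open>auto simp: grid_def\<close>)
  then show ?thesis unfolding assms(10)
  proof (rule ham_join[OF _ ham_column[OF assms(3)] _ assms(9)])
    show "M = replicate_mset a 3 + replicate_mset b 3 + {#1#} + replicate_mset c 3 +
        {#linear_length j l#}"
      unfolding assms(8,11) by (simp add: len_mset_def replicate_mset_plus numeral_2_eq_2)
  qed (use assms(5,6) in \<open>auto simp: grid_def\<close>)
qed

text \<open>The order of the classes depends on \<open>n\<close> modulo 3, because the tops of the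
  first two and the bottoms of the last two must be neighbours. The path ends at the top of the
  third class; from either of the two possible ends a step 1 or 3 leads to \<open>n\<close>.\<close>

lemma ham_tracks_from_0:
  assumes "3 \<le> n"
  shows "\<exists>w\<in>{n - 1, n - 3}. ham_path {..<n} 0 w (len_mset y 2 (n - 3) 0)"
proof -
  have "\<exists>k. n = 3 * k + 3 \<or> n = 3 * k + 4 \<or> n = 3 * k + 5"
    using assms by presburger
  then obtain k where "n = 3 * k + 3 \<or> n = 3 * k + 4 \<or> n = 3 * k + 5" ..
  then consider "n = 3 * k + 3" | "n = 3 * k + 4" | "n = 3 * k + 5" by blast
  then show ?thesis
  proof cases
    case 1
    have "ham_path {..<n} 0 (n - 1) (len_mset y 2 (n - 3) 0)"
    proof (rule ham_three_tracks[of 0 1 2 k k _ k])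
      show "len_mset y 2 (n - 3) 0 = len_mset y 2 (k + k + k) 0"
        using 1 by (intro len_mset_cong) auto
    qed (use 1 thirds(1)[of n "Suc k"] in \<open>simp_all add: linear_length_def Un_ac\<close>)
    then show ?thesis by blast
  next
    case 2
    have "ham_path {..<n} 0 (n - 3) (len_mset y 2 (n - 3) 0)"
    proof (rule ham_three_tracks[of 0 2 1 "Suc k" k _ k])
      show "len_mset y 2 (n - 3) 0 = len_mset y 2 (Suc k + k + k) 0"
        using 2 by (intro len_mset_cong) auto
    qed (use 2 thirds(2)[of n "Suc k"] in \<open>simp_all add: linear_length_def Un_ac\<close>)
    then show ?thesis by blast
  next
    case 3
    have "ham_path {..<n} 0 (n - 3) (len_mset y 2 (n - 3) 0)"
    proof (rule ham_three_tracks[of 0 1 2 "Suc k" "Suc k" _ k])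
      show "len_mset y 2 (n - 3) 0 = len_mset y 2 (Suc k + Suc k + k) 0"
        using 3 by (intro len_mset_cong) auto
    qed (use 3 thirds(3)[of n "Suc k"] in \<open>simp_all add: linear_length_def Un_ac\<close>)
    then show ?thesis by blast
  qed
qed

text \<open>A step 3 from the last vertex of an interval leads to the third vertex of the next one,
  hence the start at \<open>2\<close>.\<close>

lemma ham_tracks_from_2:
  assumes "3 \<le> n"
  shows "\<exists>w\<in>{n - 1, n - 3}. ham_path {..<n} 2 w (len_mset y 2 (n - 3) 0)"
proof -
  have "\<exists>k. n = 3 * k + 3 \<or> n = 3 * k + 4 \<or> n = 3 * k + 5"
    using assms by presburger
  then obtain k where "n = 3 * k + 3 \<or> n = 3 * k + 4 \<or> n = 3 * k + 5" ..
  then consider "n = 3 * k + 3" | "n = 3 * k + 4" | "n = 3 * k + 5" by blast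
  then show ?thesis
  proof cases
    case 1
    have "ham_path {..<n} 2 (n - 3) (len_mset y 2 (n - 3) 0)"
    proof (rule ham_three_tracks[of 2 1 0 k k _ k])
      show "len_mset y 2 (n - 3) 0 = len_mset y 2 (k + k + k) 0"
        using 1 by (intro len_mset_cong) auto
    qed (use 1 thirds(1)[of n "Suc k"] in \<open>simp_all add: linear_length_def Un_ac\<close>)
    then show ?thesis by blast
  next
    case 2
    have "ham_path {..<n} 2 (n - 1) (len_mset y 2 (n - 3) 0)"
    proof (rule ham_three_tracks[of 2 1 0 k k _ "Suc k"])
      show "len_mset y 2 (n - 3) 0 = len_mset y 2 (k + k + Suc k) 0"
        using 2 by (intro len_mset_cong) auto
    qed (use 2 thirds(2)[of n "Suc k"] in \<open>simp_all add: linear_length_def Un_ac\<close>)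
    then show ?thesis by blast
  next
    case 3
    have "ham_path {..<n} 2 (n - 1) (len_mset y 2 (n - 3) 0)"
    proof (rule ham_three_tracks[of 2 0 1 k "Suc k" _ "Suc k"])
      show "len_mset y 2 (n - 3) 0 = len_mset y 2 (k + Suc k + Suc k) 0"
        using 3 by (intro len_mset_cong) auto
    qed (use 3 thirds(3)[of n "Suc k"] in \<open>simp_all add: linear_length_def Un_ac\<close>)
    then show ?thesis by blast
  qed
qed

lemma ham_tracks_up:
  assumes "k + 3 \<le> m" "s = k \<or> s = k + 2"
  shows "\<exists>w\<in>{m - 1, m - 3}. ham_path {k..<m} s w (len_mset y 2 (m - k - 3) 0)"
proof -
  have "\<exists>w\<in>{m - k - 1, m - k - 3}. ham_path {..<m - k} (s - k) w (len_mset y 2 (m - k - 3) 0)"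
    using assms ham_tracks_from_0[of "m - k" y] ham_tracks_from_2[of "m - k" y]
    by (elim disjE) simp_all
  then obtain w where w: "w = m - k - 1 \<or> w = m - k - 3"
    "ham_path {..<m - k} (s - k) w (len_mset y 2 (m - k - 3) 0)" by blast
  have "ham_path {k..<m} s (k + w) (len_mset y 2 (m - k - 3) 0)"
    by (rule ham_shift[OF w(2), of _ k])
      (use assms in \<open>auto simp: lessThan_atLeast0 image_add_atLeastLessThan\<close>)
  then show ?thesis using w(1) assms by (intro bexI[of _ "k + w"]) auto
qed

text \<open>Reflecting the interval exchanges the possible starts \<open>k\<close>,
  \<open>k + 2\<close> with the possible ends \<open>m - 1\<close>, \<open>m - 3\<close>.\<close>

lemma ham_tracks_down:
  assumes "k + 3 \<le> m" "s = m - 1 \<or> s = m - 3"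
  shows "\<exists>w\<in>{k, k + 2}. ham_path {k..<m} s w (len_mset y 2 (m - k - 3) 0)"
proof -
  have "\<exists>w\<in>{m - 1, m - 3}. ham_path {k..<m} (m - 1 + k - s) w (len_mset y 2 (m - k - 3) 0)"
    by (rule ham_tracks_up) (use assms in auto)
  then obtain w where w: "w = m - 1 \<or> w = m - 3"
    "ham_path {k..<m} (m - 1 + k - s) w (len_mset y 2 (m - k - 3) 0)" by blast
  have "ham_path {k..<m} s (m - 1 + k - w) (len_mset y 2 (m - k - 3) 0)"
    by (rule ham_reflect[OF w(2), of "m - 1 + k"])
      (use assms reflect_interval[of m "m - 1 + k" k] in auto)
  then show ?thesis using w(1) assms by (intro bexI[of _ "m - 1 + k - w"]) auto
qed


lemma ham_run_up:
  assumes "k < m"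
  shows "ham_path {k..<m} k (m - 1) (len_mset y (m - k - 1) 0 0)"
proof -
  have "ham_path {k..<m} k (m - 1) (replicate_mset (m - k - 1) 1)"
    by (rule ham_shift[OF ham_run[of "m - k - 1"], of _ k])
      (use assms in \<open>auto simp: atMost_atLeast0 image_add_atLeastAtMost\<close>)
  then show ?thesis by (simp add: len_mset_def)
qed

lemma ham_run_down: "k < m \<Longrightarrow> ham_path {k..<m} (m - 1) k (len_mset y (m - k - 1) 0 0)"
  by (rule ham_rev[OF ham_run_up])

lemma standard_ones: "standard (Suc a) (len_mset y a 0 0)"
  unfolding standard_def using ham_run_up[of 0 "Suc a" y] by (auto simp: lessThan_atLeast0)

text \<open>Three tracks use exactly two ones, and further ones are put in front; without threes a
  plain run suffices.\<close>

lemma standard_ones_threes: "2 \<le> a \<or> b = 0 \<Longrightarrow> standard (Suc (a + b)) (len_mset y a b 0)"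
proof -
  assume "2 \<le> a \<or> b = 0"
  then consider "b = 0" | "2 \<le> a" by blast
  then show ?thesis
  proof cases
    case 2
    have "standard (b + 3) (len_mset y 2 b 0)"
      unfolding standard_def using ham_tracks_from_0[of "b + 3" y] by auto
    then show ?thesis
      by (rule standard_prefix[where k = "a - 2"])
        (use 2 in \<open>auto simp: len_mset_def intro!: multiset_eqI\<close>)
  qed (simp add: standard_ones)
qed

lemma standard_glue:
  assumes "standard (Suc (a' + b' + c)) (len_mset y a' b' c)" "a' \<le> a" "b' \<le> b"
    and "a' + 2 \<le> a \<or> b' = b"
  shows "has_linear_realization (a + b + c + 1) (len_mset y a b c)"
proof (rule standard_join[OF assms(1) standard_ones_threes])
  show "2 \<le> a - a' \<or> b - b' = 0" using assms by auto
  show "len_mset y a b c = len_mset y a' b' c + len_mset y (a - a') (b - b') 0"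
    using assms by (simp add: len_mset_add)
qed (use assms in auto)

section \<open>Standard realizations from column sequences\<close>

lemma ivl_subset: "{m..<n} \<subseteq> {..<n::nat}"
  by auto

text \<open>The number of lengths \<open>y\<close> in a turned path: \<open>R - 2\<close> taller
  columns in full, the column divided by the turn, column \<open>0\<close>, and the short columns.
  It is one less than for a plain traversal.\<close>

lemma grid_count:
  assumes "2 \<le> R" "R \<le> (y :: nat)"
  shows "(R - 2) * Suc k + k + Suc k + (y - R) * k = y * k + R - 1"
proof -
  have "y = 2 + (R - 2) + (y - R)" using assms by simp
  then have "y * k = (2 + (R - 2) + (y - R)) * k" by (rule arg_cong)
  then have "y * k = k + k + (R - 2) * k + (y - R) * k" by (simp only: add_mult_distrib mult_2)
  then show ?thesis using assms(1) by simp
qed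

text \<open>An even number of taller columns brings the snake back to the bottom row, where the
  short columns can be entered.\<close>

lemma standard_low_high:
  assumes "ham_path {..<R} 0 w M" "ham_path {R..<y} u z N" "even R"
    and "K = M + N + {#linear_length w u#} + replicate_mset (y * k + R) y"
  shows "standard (y * Suc k + R) K"
proof -
  have R: "0 < R" "R < y" using ham_in[OF assms(1)] ham_in[OF assms(2)] by auto
  have "ham_path (grid y {..<R} (Suc (Suc k))) 0 w (M + replicate_mset (R * Suc k) y)"
    using ham_snake_up[OF assms(1), of y "Suc k"] R assms(3) by simp
  moreover have "ham_path (grid y {R..<y} (Suc k)) u (if even (card {R..<y}) then z else y * k + z)
      (N + replicate_mset ((y - R) * k) y)"
    using ham_snake_up[OF assms(2) ivl_subset, of k] by simp
  ultimately have "ham_path {..<y * Suc k + R} 0 (if even (card {R..<y}) then z else y * k + z) K"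
  proof (rule ham_join)
    show "{..<y * Suc k + R} = grid y {..<R} (Suc (Suc k)) \<union> grid y {R..<y} (Suc k)"
      using R by (intro grid_full) auto
    have "R * Suc k + (y - R) * k = y * k + R"
      using R by (simp add: algebra_simps diff_mult_distrib)
    then show "K = M + replicate_mset (R * Suc k) y + (N + replicate_mset ((y - R) * k) y) +
        {#linear_length w u#}"
      using assms(4) by (simp add: replicate_mset_plus flip: \<open>_ = y * k + R\<close>)
  qed (auto intro!: grid_disjoint)
  then show ?thesis unfolding standard_def by blast
qed

lemma standard_rows:
  assumes "ham_path {..<y} 0 w M" "K = M + replicate_mset (y * k) y"
  shows "standard (y * Suc k) K"
proof -
  have "0 < y" using ham_in[OF assms(1)] by simp
  then have "{..<y * Suc k} = grid y {..<y} (Suc k)"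
    using grid_full[of 0 y "Suc k"] by (auto simp: grid_def)
  then show ?thesis
    unfolding standard_def using ham_snake_up[OF assms(1), of y k] assms(2) by auto
qed

text \<open>
  The top of column \<open>0\<close> is \<open>y * Suc k\<close>, and \<open>y * k + u\<close> is the top of the shorter column \<open>u\<close>, hence
  the step of length \<open>y - u\<close> around the right border.
\<close>

lemma ham_wrap_high:
  assumes "ham_path F s (y * Suc k) M" "F \<subseteq> grid y {0} m" "ham_path {R..<y} u w N" "0 < R"
    and "z = (if even (y - R) then y * k + w else w)"
    and "K = M + N + {#y - u#} + replicate_mset ((y - R) * k) y"
  shows "ham_path (F \<union> grid y {R..<y} (Suc k)) s z K"
proof -
  have u: "u < y" using ham_in[OF assms(3)] by simp
  have "ham_path (grid y {R..<y} (Suc k)) (y * k + u) z (N + replicate_mset ((y - R) * k) y)"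
    using ham_snake_down[OF assms(3) ivl_subset, of k] assms(5) by simp
  with assms(1) show ?thesis
  proof (rule ham_join)
    have "grid y {0} m \<inter> grid y {R..<y} (Suc k) = {}"
      using assms(4) by (intro grid_disjoint) auto
    then show "F \<inter> grid y {R..<y} (Suc k) = {}" using assms(2) by blast
    show "K = M + (N + replicate_mset ((y - R) * k) y) + {#linear_length (y * Suc k) (y * k + u)#}"
      using u assms(6) by (simp add: linear_length_def)
  qed simp
qed

text \<open>Here column \<open>0\<close> is the only taller one. Nothing follows the short columns,
  so their number may have either parity.\<close>

lemma standard_first_high:
  assumes "ham_path {1..<y} u w N" "K = N + {#y - u#} + replicate_mset (y * k + 1) y"
  shows "standard (y * Suc k + 1) K"
proof -
  have y: "1 < y" using ham_in[OF assms(1)] by auto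
  have "ham_path (grid y {0} (Suc (Suc k))) 0 (y * Suc k) (replicate_mset (Suc k) y)"
    using ham_column[of 0 y "Suc k"] y by simp
  from ham_wrap_high[OF this subset_refl assms(1) _ refl refl]
  have "ham_path (grid y {0} (Suc (Suc k)) \<union> grid y {1..<y} (Suc k)) 0
     (if even (y - 1) then y * k + w else w)
     (replicate_mset (Suc k) y + N + {#y - u#} + replicate_mset ((y - 1) * k) y)"
    by simp
  moreover have "{..<y * Suc k + 1} = grid y {0} (Suc (Suc k)) \<union> grid y {1..<y} (Suc k)"
    using grid_full[of 1 y "Suc k"] y by (simp add: lessThan_Suc)
  moreover have "Suc k + (y - 1) * k = y * k + 1"
    using y by (simp add: diff_mult_distrib)
  then have "replicate_mset (y * k + 1) y = replicate_mset (Suc k) y + replicate_mset ((y - 1) * k) y"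
    by (simp flip: replicate_mset_plus)
  ultimately show ?thesis unfolding standard_def using assms(2) by (auto simp: ac_simps)
qed

text \<open>An odd number of short columns, entered at the top, is left at the bottom, where the
  other taller columns can be entered. \<open>F\<close> is column \<open>0\<close>, possibly without
  its vertex \<open>0\<close>; the path on the taller columns is left open so that it may contain a
  turn.\<close>

lemma ham_wrap_high_low:
  assumes "ham_path F s (y * Suc k) M" "F \<subseteq> grid y {0} m" "ham_path {R..<y} u w N" "odd (y - R)"
    and "ham_path (grid y {1..<R} (Suc (Suc k))) u' z P"
    and "V = F \<union> grid y {R..<y} (Suc k) \<union> grid y {1..<R} (Suc (Suc k))"
    and "K = M + N + P + {#y - u#} + {#linear_length w u'#} + replicate_mset ((y - R) * k) y"
  shows "ham_path V s z K"
proof -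
  have "u' mod y \<in> {1..<R}" using ham_in[OF assms(5)] by (simp add: grid_def)
  then have "ham_path (F \<union> grid y {R..<y} (Suc k)) s w
      (M + N + {#y - u#} + replicate_mset ((y - R) * k) y)"
    using assms(4) by (intro ham_wrap_high[OF assms(1-3)]) auto
  then show ?thesis
  proof (rule ham_join[OF _ assms(5) _ assms(6)])
    have "grid y {0} m \<inter> grid y {1..<R} (Suc (Suc k)) = {}"
      "grid y {R..<y} (Suc k) \<inter> grid y {1..<R} (Suc (Suc k)) = {}"
      by (auto intro!: grid_disjoint)
    then show "(F \<union> grid y {R..<y} (Suc k)) \<inter> grid y {1..<R} (Suc (Suc k)) = {}"
      using assms(2) by blast
  qed (simp add: assms(7) ac_simps)
qed

lemma standard_first_high_low:
  assumes "ham_path {R..<y} u w N" "odd (y - R)" "ham_path (grid y {1..<R} (Suc (Suc k))) u' z P"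
    and "K = N + P + {#y - u#} + {#linear_length w u'#} + replicate_mset (Suc k + (y - R) * k) y"
  shows "standard (y * Suc k + R) K"
proof -
  have "u' mod y \<in> {1..<R}" using ham_in[OF assms(3)] by (simp add: grid_def)
  then have R: "1 < R" "R < y" using ham_in[OF assms(1)] by auto
  have "ham_path (grid y {0} (Suc (Suc k))) 0 (y * Suc k) (replicate_mset (Suc k) y)"
    using ham_column[of 0 y "Suc k"] R by simp
  then have "ham_path {..<y * Suc k + R} 0 z K"
  proof (rule ham_wrap_high_low[OF _ subset_refl assms(1-3)])
    have "{..<R} = {0} \<union> {1..<R}" using R by auto
    then have "grid y {..<R} (Suc (Suc k)) = grid y {0} (Suc (Suc k)) \<union> grid y {1..<R} (Suc (Suc k))"
      by (metis grid_Un)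
    then show "{..<y * Suc k + R} = grid y {0} (Suc (Suc k)) \<union> grid y {R..<y} (Suc k) \<union>
        grid y {1..<R} (Suc (Suc k))"
      using grid_full[of R y "Suc k"] R by (simp add: Un_ac)
    show "K = replicate_mset (Suc k) y + N + P + {#y - u#} + {#linear_length w u'#} +
        replicate_mset ((y - R) * k) y"
      unfolding assms(4) replicate_mset_plus by (simp add: ac_simps)
  qed
  then show ?thesis unfolding standard_def by blast
qed

section \<open>Multiplicity of \<open>y\<close> congruent to 0 or 1\<close>

lemma standard_cong: "standard n M \<Longrightarrow> n = n' \<Longrightarrow> M = M' \<Longrightarrow> standard n' M'"
  by simp

lemma standard_reflect:
  assumes "standard m M"
  shows "\<exists>w. ham_path {k..<k + m} (k + m - 1) w M"
proof -
  obtain w where w: "ham_path {..<m} 0 w M" using assms unfolding standard_def by blast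
  then have "0 < m" using ham_in by blast
  have "ham_path {k..<k + m} (k + 0) (k + w) M"
    by (rule ham_shift[OF w])
      (simp_all add: lessThan_atLeast0 image_add_atLeastLessThan add.commute)
  then have "ham_path {k..<k + m} (k + m - 1) (k + k + m - 1 - (k + w)) M"
    by (rule ham_reflect[where N = "k + k + m - 1"])
      (use \<open>0 < m\<close> reflect_interval[of "k + m" "k + k + m - 1" k] in auto)
  then show ?thesis by blast
qed

text \<open>For residue 0 all rows are complete. For residue 1 column \<open>0\<close> is taken
  first. If \<open>a = 2\<close>, the tracks need both ones and the step around the border is a 3,
  to column \<open>y - 3\<close>; otherwise it is a 1, to column \<open>y - 1\<close>.\<close>

lemma standard_residue_0_or_1:
  assumes "4 \<le> y" "2 \<le> a" "a + b + 1 = y" "c mod y = 0 \<or> c mod y = 1"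
  shows "standard (Suc (a + b + c)) (len_mset y a b c)"
proof -
  define k where "k = c div y"
  have c: "c = y * k + c mod y" by (simp add: k_def)
  consider "c mod y = 0" | "c mod y = 1" "a = 2" | "c mod y = 1" "3 \<le> a"
    using assms(2,4) by linarith
  then show ?thesis
  proof cases
    case 1
    obtain w where "ham_path {..<y} 0 w (len_mset y a b 0)"
      using standard_ones_threes[of a b y] assms(2,3) unfolding standard_def by auto
    then have "standard (y * Suc k) (len_mset y a b 0 + replicate_mset (y * k) y)"
      by (rule standard_rows) simp
    then show ?thesis
      by (rule standard_cong) (use assms(3) 1 c in \<open>simp_all add: len_mset_def\<close>)
  next
    case 2
    obtain w where "ham_path {1..<y} (y - 3) w (len_mset y 2 (y - 1 - 3) 0)"
      using ham_tracks_down[of 1 y "y - 3" y] assms(1) by auto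
    from standard_first_high[OF this refl, of k]
    have "standard (y * Suc k + 1) (len_mset y 2 (y - 1 - 3) 0 + {#y - (y - 3)#} + replicate_mset (y * k + 1) y)" .
    then show ?thesis
    proof (rule standard_cong)
      have "y - (y - 3) = 3" "b = Suc (y - 1 - 3)" "c = y * k + 1" using assms 2 c by auto
      then show "len_mset y 2 (y - 1 - 3) 0 + {#y - (y - 3)#} + replicate_mset (y * k + 1) y = len_mset y a b c"
        by (simp add: len_mset_def 2(2) del: One_nat_def)
      show "y * Suc k + 1 = Suc (a + b + c)" using assms(3) 2 c by simp
    qed
  next
    case 3
    have "standard (y - 1) (len_mset y (a - 1) b 0)"
      by (rule standard_cong[OF standard_ones_threes[of "a - 1" b y]]) (use 3 assms(3) in auto)
    from standard_reflect[OF this, of 1] obtain w where "ham_path {1..<y} (y - 1) w (len_mset y (a - 1) b 0)"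
      using assms(1) by auto
    from standard_first_high[OF this refl, of k]
    have "standard (y * Suc k + 1) (len_mset y (a - 1) b 0 + {#y - (y - 1)#} + replicate_mset (y * k + 1) y)" .
    then show ?thesis
    proof (rule standard_cong)
      have "y - (y - 1) = 1" "a = Suc (a - 1)" "c = y * k + 1" using assms 3 c by auto
      then show "len_mset y (a - 1) b 0 + {#y - (y - 1)#} + replicate_mset (y * k + 1) y = len_mset y a b c"
        by (metis add_cancel_right_right len_mset_add len_mset_single(1,5) plus_1_eq_Suc add.commute add_0)
      show "y * Suc k + 1 = Suc (a + b + c)" using assms(3) 3 c by simp
    qed
  qed
qed

text \<open>If there are enough threes, the columns use only two ones and at least two are left for
  the rest. Otherwise they use all threes, and the rest consists of ones.\<close>

lemma realization_residue_0_or_1: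
  assumes "4 \<le> y" "4 \<le> a" "y + 1 \<le> a + b" "c mod y = 0 \<or> c mod y = 1"
  shows "has_linear_realization (a + b + c + 1) (len_mset y a b c)"
proof (cases "y - 3 \<le> b")
  case True
  then show ?thesis
    using assms by (intro standard_glue[OF standard_residue_0_or_1[of y 2 "y - 3"]]) auto
next
  case False
  then show ?thesis
    using assms by (intro standard_glue[OF standard_residue_0_or_1[of y "y - 1 - b" b]]) auto
qed

section \<open>Many threes\<close>

text \<open>\<open>of_bool\<close> counts a link of length 1 or 3 without a case
  distinction.\<close>

lemma len_mset_step: "d = 1 \<or> d = 3 \<Longrightarrow> {#d#} = len_mset y (of_bool (d = 1)) (of_bool (d = 3)) 0"
  by (auto simp: len_mset_def)

lemma standard_low_high_len_mset:
  assumes "ham_path {..<R} 0 w (len_mset y a b 0)" "ham_path {R..<y} u z (len_mset y a' b' 0)" "even R"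
    and "linear_length w u = d" "d = 1 \<or> d = 3" "c = y * k + R"
    and "A = a + a' + of_bool (d = 1)" "B = b + b' + of_bool (d = 3)"
  shows "standard (y + c) (len_mset y A B c)"
proof -
  have "standard (y * Suc k + R) (len_mset y a b 0 + len_mset y a' b' 0 + {#linear_length w u#} +
      replicate_mset (y * k + R) y)"
    by (rule standard_low_high[OF assms(1-3) refl])
  then show ?thesis
    unfolding assms(4) len_mset_step[OF assms(5), of y] len_mset_single(5) len_mset_add
    by (rule standard_cong) (use assms(6-8) in \<open>auto intro!: len_mset_cong\<close>)
qed

lemma standard_first_high_low_len_mset:
  assumes "ham_path {R..<y} u w (len_mset y a b 0)" "odd (y - R)"
    and "ham_path (grid y {1..<R} (Suc (Suc k))) u' z (len_mset y a' b' c')"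
    and "y - u = e" "e = 1 \<or> e = 3" "linear_length w u' = d" "d = 1 \<or> d = 3"
    and "A = a + a' + of_bool (e = 1) + of_bool (d = 1)"
    and "B = b + b' + of_bool (e = 3) + of_bool (d = 3)"
    and "C = c' + Suc k + (y - R) * k" "n = y * Suc k + R"
  shows "standard n (len_mset y A B C)"
proof -
  have "standard (y * Suc k + R) (len_mset y a b 0 + len_mset y a' b' c' + {#y - u#} + {#linear_length w u'#} +
      replicate_mset (Suc k + (y - R) * k) y)"
    by (rule standard_first_high_low[OF assms(1-3) refl])
  then show ?thesis
    unfolding assms(4,6) len_mset_step[OF assms(5), of y] len_mset_step[OF assms(7), of y] len_mset_single(5) len_mset_add
    by (rule standard_cong) (use assms(8-11) in \<open>auto intro!: len_mset_cong\<close>)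
qed

text \<open>The path continues from \<open>w\<close> to column \<open>v\<close>, one of the columns below \<open>R\<close>.\<close>

lemma descent_high:
  assumes "R < y" "odd (y - R)" "3 \<le> R"
  obtains u w v a b where "ham_path {R..<y} u w (len_mset y a b 0)"
    "y - u = 1 \<or> y - u = 3" "linear_length w v = 1 \<or> linear_length w v = 3"
    "v + 1 = R \<or> v + 3 = R"
    "a + of_bool (y - u = 1) + of_bool (linear_length w v = 1) = 2"
    "b + of_bool (y - u = 3) + of_bool (linear_length w v = 3) + R + 1 = y"
proof (cases "y - R = 1")
  case True
  then have "{R..<y} = {R}" by auto
  then have "ham_path {R..<y} R R (len_mset y 0 0 0)"
    using ham_singleton[of R] by (simp add: len_mset_def)
  then show ?thesis
    using True assms(3) by (intro that[of R R 0 0 "R - 1"]) (auto simp: linear_length_def)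
next
  case False
  then have "R + 3 \<le> y" using assms by presburger
  from ham_tracks_down[OF this, of "y - 3" y] obtain w where
    w: "w = R \<or> w = R + 2" "ham_path {R..<y} (y - 3) w (len_mset y 2 (y - R - 3) 0)" by auto
  then show ?thesis
    \<comment> \<open>The tracks supply the two ones, so both links are threes: around the border to
      \<open>y - 3\<close>, and from \<open>w\<close> to \<open>w - 3\<close>, which is
      \<open>R - 3\<close> or \<open>R - 1\<close>.\<close>
    using assms(3) \<open>R + 3 \<le> y\<close>
    by (intro that[of "y - 3" w 2 "y - R - 3" "w - 3"]) (auto simp: linear_length_def)
qed

text \<open>The bound \<open>3 <= a\<close> gives \<open>b <= y - 4\<close>, and
  \<open>a <= 5\<close> leaves two of seven ones for the rest. The three cases treat too few taller
  columns for three tracks, enough columns on both sides, and too few short columns.\<close>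

lemma standard_even_residue:
  assumes "7 \<le> y" "even r" "2 \<le> r" "r < y" "c = y * k + r"
  shows "\<exists>a b. 3 \<le> a \<and> a \<le> 5 \<and> a + b + 1 = y \<and> standard (y + c) (len_mset y a b c)"
proof -
  have "r = 2 \<or> 4 \<le> r" using assms(2,3) by presburger
  then consider "r = 2" | "4 \<le> r" "r + 3 \<le> y" | "4 \<le> r" "y \<le> r + 2" by linarith
  then show ?thesis
  proof cases
    case 1
    have "ham_path {..<r} 0 1 (len_mset y 1 0 0)"
      using ham_run_up[of 0 2 y] 1 by (simp add: lessThan_atLeast0)
    moreover obtain z where "ham_path {r..<y} 2 z (len_mset y 2 (y - 5) 0)"
      using ham_tracks_up[of 2 y 2 y] assms(1) 1 by auto
    ultimately have "standard (y + c) (len_mset y 4 (y - 5) c)"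
      by (rule standard_low_high_len_mset[where d = 1]) (use assms in \<open>auto simp: linear_length_def\<close>)
    then show ?thesis using assms(1) by (intro exI[of _ 4] exI[of _ "y - 5"]) auto
  next
    case 2
    obtain w where w: "w = r - 1 \<or> w = r - 3" "ham_path {..<r} 0 w (len_mset y 2 (r - 3) 0)"
      using ham_tracks_from_0[of r y] 2 by auto
    obtain z where z: "ham_path {r..<y} (w + 3) z (len_mset y 2 (y - r - 3) 0)"
      using ham_tracks_up[of r y "w + 3" y] 2 w(1) by auto
    have "standard (y + c) (len_mset y 4 (y - 5) c)"
      by (rule standard_low_high_len_mset[OF w(2) z, where d = 3])
        (use assms 2 in \<open>auto simp: linear_length_def\<close>)
    then show ?thesis using assms(1) by (intro exI[of _ 4] exI[of _ "y - 5"]) auto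
  next
    case 3
    \<comment> \<open>Starting the tracks at \<open>1\<close> spends an extra one on the step from
      \<open>0\<close>, which guarantees at least three ones.\<close>
    obtain w where w: "w = r - 1 \<or> w = r - 3" "ham_path {1..<r} 1 w (len_mset y 2 (r - 4) 0)"
      using ham_tracks_up[of 1 r 1 y] 3 by auto
    have "ham_path {..<r} 0 w (len_mset y 3 (r - 4) 0)"
      by (rule ham_join[OF ham_singleton w(2)])
        (use 3 in \<open>auto simp: linear_length_def len_mset_def numeral_3_eq_3 numeral_2_eq_2\<close>)
    moreover have "ham_path {r..<y} r (y - 1) (len_mset y (y - r - 1) 0 0)"
      using assms(4) by (rule ham_run_up)
    ultimately have "standard (y + c) (len_mset y (3 + (y - r - 1) + of_bool (r - w = 1))
       (r - 4 + of_bool (r - w = 3)) c)"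
      by (rule standard_low_high_len_mset[where d = "r - w"])
        (use assms 3 w(1) in \<open>auto simp: linear_length_def\<close>)
    then show ?thesis using assms 3 w(1)
      by (intro exI[of _ "3 + (y - r - 1) + of_bool (r - w = 1)"] exI[of _ "r - 4 + of_bool (r - w = 3)"])
        auto
  qed
qed

lemma standard_odd_residue_even:
  assumes "7 \<le> y" "even y" "odd r" "2 \<le> r" "r < y" "c = y * k + r"
  shows "\<exists>a b. 3 \<le> a \<and> a \<le> 5 \<and> a + b + 1 = y \<and> standard (y + c) (len_mset y a b c)"
proof (cases "r = 3")
  \<comment> \<open>For \<open>r = 3\<close> only the columns 1 and 2 remain below, too few for
    three tracks; they are run through by a step 1.\<close>
  case True
  obtain w where w: "w = 3 \<or> w = 5" "ham_path {r..<y} (y - 3) w (len_mset y 2 (y - 6) 0)"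
    using ham_tracks_down[of 3 y "y - 3" y] assms(1) True by auto
  have "ham_path {1..<r} 2 1 (len_mset y 1 0 0)"
    using ham_run_down[of 1 3 y] True by simp
  from ham_snake_up[OF this, of y "Suc k"]
  obtain z where L: "ham_path (grid y {1..<r} (Suc (Suc k))) 2 z (len_mset y 1 0 (2 * Suc k))"
    using assms(1) True by (simp add: len_mset_single(5) len_mset_add subset_eq)
  have "standard (y + c) (len_mset y (3 + of_bool (w = 3)) (y - 5 + of_bool (w = 5)) c)"
  proof (rule standard_first_high_low_len_mset[OF w(2) _ L, where e = 3 and d = "w - 2"])
    have "y * k = 3 * k + (y - 3) * k" using assms(1) by (simp add: diff_mult_distrib)
    then show "c = 2 * Suc k + Suc k + (y - r) * k" using True assms(6) by simp
  qed (use assms True w(1) in \<open>auto simp: linear_length_def\<close>)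
  then show ?thesis using assms(1) w(1)
    by (intro exI[of _ "3 + of_bool (w = 3)"] exI[of _ "y - 5 + of_bool (w = 5)"]) auto
next
  case False
  then have r: "5 \<le> r" using assms(3,4) by presburger
  obtain u w v a b where H: "ham_path {r..<y} u w (len_mset y a b 0)"
    "y - u = 1 \<or> y - u = 3" "linear_length w v = 1 \<or> linear_length w v = 3" "v + 1 = r \<or> v + 3 = r"
    "a + of_bool (y - u = 1) + of_bool (linear_length w v = 1) = (2 :: nat)"
    "b + of_bool (y - u = 3) + of_bool (linear_length w v = 3) + r + 1 = y"
    by (rule descent_high[of r y]) (use assms r in auto)
  obtain z where "ham_path {1..<r} v z (len_mset y 2 (r - 4) 0)"
    using ham_tracks_down[of 1 r v y] r H(4) by force
  from ham_snake_up[OF this, of y "Suc k"]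
  obtain z where L: "ham_path (grid y {1..<r} (Suc (Suc k))) v z (len_mset y 2 (r - 4) ((r - 1) * Suc k))"
    using assms(5) by (simp add: len_mset_single(5) len_mset_add subset_eq)
  have "standard (y + c) (len_mset y 4 (y - 5) c)"
  proof (rule standard_first_high_low_len_mset[OF H(1) _ L refl H(2) refl H(3)])
    have "y * k = k + (r - 1) * k + (y - r) * k"
      using assms(5) r by (simp flip: add_mult_distrib mult_Suc)
    then show "c = (r - 1) * Suc k + Suc k + (y - r) * k" using assms(6) r by simp
  qed (use assms r H(5,6) in auto)
  then show ?thesis using assms(1) by (intro exI[of _ 4] exI[of _ "y - 5"]) auto
qed

lemma standard_odd_residue_odd:
  assumes "7 \<le> y" "odd y" "odd r" "2 \<le> r" "r < y" "c = y * k + r"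
  shows "\<exists>a b. 4 \<le> a \<and> a \<le> 5 \<and> a + b = y \<and> standard (y + c + 1) (len_mset y a b c)"
proof -
  \<comment> \<open>With one vertex more the last row has \<open>R\<close> vertices. Then
    \<open>y - R\<close> is odd, so column \<open>0\<close> can be taken first, and the
    \<open>R - 1\<close> other taller columns are odd in number, as the turn demands.\<close>
  define R where "R = Suc r"
  have R: "4 \<le> R" "R < y" "even R" using assms unfolding R_def by presburger+
  obtain u w v a b where H: "ham_path {R..<y} u w (len_mset y a b 0)"
    "y - u = 1 \<or> y - u = 3" "linear_length w v = 1 \<or> linear_length w v = 3" "v + 1 = R \<or> v + 3 = R"
    "a + of_bool (y - u = 1) + of_bool (linear_length w v = 1) = (2 :: nat)"
    "b + of_bool (y - u = 3) + of_bool (linear_length w v = 3) + R + 1 = y"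
    by (rule descent_high[of R y]) (use assms(2) R in auto)
  obtain z where L: "ham_path {1..<R} v z (len_mset y 2 (R - 4) 0)"
    using ham_tracks_down[of 1 R v y] R H(4) by force
  have "\<exists>d\<in>#len_mset y 2 (R - 4) 0. \<exists>z. ham_path (grid y {1..<R} (Suc (Suc k))) v z
      (len_mset y 2 (R - 4) 0 + {#d#} + replicate_mset ((card {1..<R} - 1) * Suc k + k) y)"
    by (rule ham_snake_turn_last[OF L]) (use R in auto)
  then obtain d z where "d \<in># len_mset y 2 (R - 4) 0" and z: "ham_path (grid y {1..<R} (Suc (Suc k))) v z
      (len_mset y 2 (R - 4) 0 + {#d#} + replicate_mset ((card {1..<R} - 1) * Suc k + k) y)"
    by blast
  then have d: "d = 1 \<or> d = 3" using set_mset_len_mset by blast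
  have "card {1..<R} - 1 = R - 2" by simp
  with z have L: "ham_path (grid y {1..<R} (Suc (Suc k))) v z
      (len_mset y (2 + of_bool (d = 1)) (R - 4 + of_bool (d = 3)) ((R - 2) * Suc k + k))"
    by (simp only: len_mset_step[OF d, of y] len_mset_single(5) len_mset_add add_0_right add_0)
  have "standard (y + c + 1) (len_mset y (4 + of_bool (d = 1)) (y - 5 + of_bool (d = 3)) c)"
  proof (rule standard_first_high_low_len_mset[OF H(1) _ L refl H(2) refl H(3)])
    show "c = (R - 2) * Suc k + k + Suc k + (y - R) * k"
      using grid_count[of R y k] assms(6) R by (simp add: R_def)
  qed (use assms R H(5,6) in \<open>auto simp: R_def\<close>)
  then show ?thesis using assms(1) d
    by (intro exI[of _ "4 + of_bool (d = 1)"] exI[of _ "y - 5 + of_bool (d = 3)"]) auto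
qed

lemma realization_many_threes:
  assumes "7 \<le> y" "7 \<le> a" "y - 4 \<le> b"
  shows "has_linear_realization (a + b + c + 1) (len_mset y a b c)"
proof -
  define k r where "k = c div y" and "r = c mod y"
  have c: "c = y * k + r" and r: "r < y" using assms(1) by (simp_all add: k_def r_def)
  show ?thesis
  proof (cases "2 \<le> r")
    case False
    then show ?thesis
      using assms by (intro realization_residue_0_or_1) (auto simp: r_def)
  next
    case True
    \<comment> \<open>These bounds leave at least two of the ones and fit \<open>b'\<close> into
      \<open>b\<close>. In the doubly odd case \<open>a' + b' = y\<close>, and
      \<open>4 <= a'\<close> still gives \<open>b' <= y - 4\<close>.\<close>
    have "\<exists>a' b'. 3 \<le> a' \<and> a' \<le> 5 \<and> b' + 4 \<le> y \<and> standard (Suc (a' + b' + c)) (len_mset y a' b' c)"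
    proof (cases "odd y \<and> odd r")
      case True
      then obtain a' b' where "4 \<le> a'" "a' \<le> 5" "a' + b' = y" "standard (y + c + 1) (len_mset y a' b' c)"
        using standard_odd_residue_odd[OF assms(1) _ _ \<open>2 \<le> r\<close> r c] by blast
      then show ?thesis by (intro exI[of _ a'] exI[of _ b']) auto
    next
      case False
      then obtain a' b' where "3 \<le> a'" "a' \<le> 5" "a' + b' + 1 = y" "standard (y + c) (len_mset y a' b' c)"
        using standard_odd_residue_even[OF assms(1) _ _ \<open>2 \<le> r\<close> r c]
          standard_even_residue[OF assms(1) _ \<open>2 \<le> r\<close> r c] by blast
      then show ?thesis by (intro exI[of _ a'] exI[of _ b']) auto
    qed
    then obtain a' b' where "3 \<le> a'" "a' \<le> 5" "b' + 4 \<le> y" "standard (Suc (a' + b' + c)) (len_mset y a' b' c)"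
      by blast
    then show ?thesis
      using assms by (intro standard_glue[of a' b']) auto
  qed
qed

section \<open>Many ones\<close>

lemma ham_snake_len_mset:
  assumes "ham_path S u w (len_mset y a b 0)" "S \<subseteq> {..<y}"
  shows "\<exists>z. ham_path (grid y S (Suc h)) u z (len_mset y a b (card S * h))"
  using ham_snake_up[OF assms, of h] unfolding len_mset_single(5) len_mset_add by auto

text \<open>Neighbouring columns always follow each other, by steps 1. The residue \<open>r\<close>
  selects the order: complete rows for 0, column \<open>0\<close> first for 1, left to right for
  even \<open>r\<close>, and column \<open>0\<close> followed by right to left for even
  \<open>y\<close> and odd \<open>r\<close>.\<close>

lemma standard_ones_y:
  assumes "2 \<le> y" "even y \<or> even (c mod y) \<or> c mod y = 1"
  shows "standard (y + c) (len_mset y (y - 1) 0 c)"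
proof -
  define k r where "k = c div y" and "r = c mod y"
  have c: "c = y * k + r" and r: "r < y" using assms(1) by (simp_all add: k_def r_def)
  consider "r = 0" | "r = 1" | "even r" "2 \<le> r" | "even y" "odd r" "2 \<le> r"
    using assms(2) unfolding r_def[symmetric] by fastforce
  then show ?thesis
  proof cases
    case 1
    have "ham_path {..<y} 0 (y - 1) (len_mset y (y - 1) 0 0)"
      using ham_run_up[of 0 y y] assms(1) by (simp add: lessThan_atLeast0)
    then have "standard (y * Suc k) (len_mset y (y - 1) 0 0 + replicate_mset (y * k) y)"
      by (rule standard_rows) simp
    then show ?thesis by (rule standard_cong) (use 1 c in \<open>simp_all add: len_mset_def\<close>)
  next
    case 2
    have "ham_path {1..<y} (y - 1) 1 (len_mset y (y - 2) 0 0)"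
      using ham_run_down[of 1 y y] assms(1) by (simp add: numeral_2_eq_2)
    from standard_first_high[OF this refl, of k]
    have "standard (y * Suc k + 1) (len_mset y (y - 2) 0 0 + {#y - (y - 1)#} + replicate_mset (y * k + 1) y)" .
    then show ?thesis
    proof (rule standard_cong)
      have "y - (y - 1) = 1" "y - 1 = y - 2 + 1" "c = y * k + 1" using assms 2 c by auto
      then show "len_mset y (y - 2) 0 0 + {#y - (y - 1)#} + replicate_mset (y * k + 1) y = len_mset y (y - 1) 0 c"
        by (simp only: len_mset_single(1)[of y] len_mset_single(5) len_mset_add add_0_right add_0)
    qed (use 2 c in simp)
  next
    case 3
    have "ham_path {..<r} 0 (r - 1) (len_mset y (r - 1) 0 0)"
      using ham_run_up[of 0 r y] 3 by (simp add: lessThan_atLeast0)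
    then show ?thesis
      by (rule standard_low_high_len_mset[OF _ ham_run_up[OF r], where d = 1])
        (use 3 r c in \<open>auto simp: linear_length_def\<close>)
  next
    case 4
    have "{1..<r} \<subseteq> {..<y}" using r by auto
    from ham_snake_len_mset[OF ham_run_down[of 1 r y] this, of "Suc k"] 4
    obtain z where L: "ham_path (grid y {1..<r} (Suc (Suc k))) (r - 1) z (len_mset y (r - 2) 0 ((r - 1) * Suc k))"
      by (auto simp: numeral_2_eq_2)
    show ?thesis
    proof (rule standard_first_high_low_len_mset[OF ham_run_down[OF r] _ L, where d = 1 and e = 1])
      have "y = 1 + (r - 1) + (y - r)" using r 4 by simp
      then have "y * k = (1 + (r - 1) + (y - r)) * k" by (rule arg_cong)
      then have "y * k = k + (r - 1) * k + (y - r) * k" by (simp only: add_mult_distrib mult_1)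
      then show "c = (r - 1) * Suc k + Suc k + (y - r) * k"
        using c 4 by simp
    qed (use 4 r c in \<open>auto simp: linear_length_def\<close>)
  qed
qed

text \<open>Go from column \<open>R - 1\<close> leftwards and turn inside column 2;
  \<open>{2..<R}\<close> has an even number of columns, as the turn requires.\<close>

lemma ham_low_turn:
  assumes "even R" "4 \<le> R" "R < y"
  shows "\<exists>z. ham_path (grid y {1..<R} (Suc (Suc k))) (R - 1) z (len_mset y (R - 1) 0 ((R - 2) * Suc k + k))"
proof (rule ham_snake_turn)
  show "ham_path {2..<R} (R - 1) 2 (len_mset y (R - 3) 0 0)"
    using ham_run_down[of 2 R y] assms(2) by (simp add: numeral_3_eq_3 numeral_2_eq_2)
  show "{1..<R} = {2..<R} \<union> {1}" using assms(2) by auto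
  show "1 = linear_length 2 1" by (simp add: linear_length_def)
  have "{#1, 1#} = len_mset y 2 0 0" by (simp add: len_mset_def numeral_2_eq_2)
  moreover have "R - 1 = R - 3 + 2" using assms(2) by simp
  ultimately show "len_mset y (R - 1) 0 ((R - 2) * Suc k + k) =
      len_mset y (R - 3) 0 0 + {#1, 1#} + replicate_mset (card {2..<R} * Suc k + k) y"
    by (simp only: len_mset_single(5) len_mset_add card_atLeastLessThan add_0_right add_0)
qed (use assms in auto)

text \<open>One 1 is exchanged for a 3 by jumping from column 4 to column 1 and taking 1, 2, 3 from
  left to right with the turn in 2. For \<open>R = 4\<close> this jump is the link coming from
  column \<open>R\<close>; therefore \<open>R - v\<close> is included in the counts.\<close>

lemma ham_low_turn_three:
  assumes "even R" "4 \<le> R" "R < y"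
  shows "\<exists>v z a b. ham_path (grid y {1..<R} (Suc (Suc k))) v z (len_mset y a b ((R - 2) * Suc k + k)) \<and>
    (R - v = 1 \<or> R - v = 3) \<and> v < R \<and> a + of_bool (R - v = 1) = R - 1 \<and> b + of_bool (R - v = 3) = 1"
proof -
  have "\<exists>z. ham_path (grid y {1..<4} (Suc (Suc k))) 1 z (len_mset y 3 0 (2 * Suc k + k))"
  proof (rule ham_snake_turn)
    show "ham_path {1..<3} 1 2 (len_mset y 1 0 0)"
      using ham_run_up[of 1 3 y] by simp
    show "{1..<4} = {1..<3} \<union> {3::nat}" by auto
    show "1 = linear_length 2 3" by (simp add: linear_length_def)
    show "len_mset y 3 0 (2 * Suc k + k) =
        len_mset y 1 0 0 + {#1, 1#} + replicate_mset (card {1..<3::nat} * Suc k + k) y"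
      by (simp add: len_mset_def numeral_3_eq_3 numeral_2_eq_2)
  qed (use assms in auto)
  then obtain z where z: "ham_path (grid y {1..<4} (Suc (Suc k))) 1 z (len_mset y 3 0 (2 * Suc k + k))"
    by blast
  show ?thesis
  proof (cases "R = 4")
    case True
    then show ?thesis using z
      by (intro exI[of _ 1] exI[of _ z] exI[of _ 3] exI[of _ 0]) simp
  next
    case False
    then have R: "6 \<le> R" using assms(1,2) by presburger
    have "ham_path (grid y {4..<R} (Suc (Suc k))) (R - 1) 4
        (len_mset y (R - 4 - 1) 0 0 + replicate_mset ((R - 4) * Suc k) y)"
      using ham_snake_up[OF ham_run_down[of 4 R y], of y "Suc k"] R assms by (simp add: subset_eq)
    then have "ham_path (grid y {1..<R} (Suc (Suc k))) (R - 1) z (len_mset y (R - 2) 1 ((R - 2) * Suc k + k))"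
    proof (rule ham_join[OF _ z])
      have "{1..<R} = {4..<R} \<union> {1..<4}" using R by auto
      then show "grid y {1..<R} (Suc (Suc k)) = grid y {4..<R} (Suc (Suc k)) \<union> grid y {1..<4} (Suc (Suc k))"
        by (simp only: grid_Un)
      have "R - 2 = R - 4 - 1 + 3" "linear_length 4 1 = 3" using R by (auto simp: linear_length_def)
      moreover have "R - 2 = R - 4 + 2" using R by simp
      then have "(R - 2) * Suc k = (R - 4) * Suc k + 2 * Suc k"
        by (simp only: add_mult_distrib)
      ultimately show "len_mset y (R - 2) 1 ((R - 2) * Suc k + k) =
          len_mset y (R - 4 - 1) 0 0 + replicate_mset ((R - 4) * Suc k) y + len_mset y 3 0 (2 * Suc k + k) +
          {#linear_length 4 1#}"
        by (simp only: len_mset_single(2)[of y] len_mset_single(5) len_mset_add add_0_right add_0 add.assoc)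
    qed (auto intro!: grid_disjoint)
    then show ?thesis using R
      by (intro exI[of _ "R - 1"] exI[of _ z] exI[of _ "R - 2"] exI[of _ 1]) simp
  qed
qed

lemma odd_residue_bounds:
  assumes "odd (y :: nat)" "odd (c mod y)" "c mod y \<noteq> 1"
  obtains k R where "even R" "4 \<le> R" "R < y" "c + 1 = y * k + R" "odd (y - R)"
    "c mod y + 1 = R" "k = c div y"
proof -
  have "0 < y" using assms(1) by (rule odd_pos)
  then have "c mod y < y" by simp
  then have "Suc (c mod y) < y" using assms(1,2) by (metis Suc_lessI even_Suc)
  moreover have "4 \<le> Suc (c mod y)"
  proof -
    have "odd m \<Longrightarrow> m \<noteq> 1 \<Longrightarrow> 4 \<le> Suc m" for m :: nat by presburger
    then show ?thesis using assms(2,3) by blast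
  qed
  moreover have "c + 1 = y * (c div y) + Suc (c mod y)" by simp
  moreover have "odd (y - Suc (c mod y))" using assms(1,2) \<open>Suc (c mod y) < y\<close> by simp
  ultimately show ?thesis
    by (intro that[of "Suc (c mod y)" "c div y"]) (simp add: assms(2) | assumption | rule refl)+
qed

text \<open>If threes are present and \<open>a = y + 1\<close>, at most \<open>y - 1\<close> ones
  may be spent before gluing. The second version meets this bound.\<close>

lemma standard_ones_y_odd:
  assumes "odd y" "odd (c mod y)" "c mod y \<noteq> 1"
  shows "standard (y + c + 1) (len_mset y y 0 c)"
    and "standard (y + c + 1) (len_mset y (y - 1) 1 c)"
proof -
  obtain k R where R: "even R" "4 \<le> R" "R < y" "c + 1 = y * k + R" "odd (y - R)"
    using odd_residue_bounds[OF assms] by metis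
  have c: "c = (R - 2) * Suc k + k + Suc k + (y - R) * k"
    using grid_count[of R y k] R by simp
  have n: "y + c + 1 = y * Suc k + R" using R(4) by simp
  have H: "ham_path {R..<y} (y - 1) R (len_mset y (y - R - 1) 0 0)" using R(3) by (rule ham_run_down)
  obtain z where L: "ham_path (grid y {1..<R} (Suc (Suc k))) (R - 1) z (len_mset y (R - 1) 0 ((R - 2) * Suc k + k))"
    using ham_low_turn[OF R(1-3)] by blast
  show "standard (y + c + 1) (len_mset y y 0 c)"
    by (rule standard_first_high_low_len_mset[OF H R(5) L, of 1 1, OF _ _ _ _ _ _ c n])
      (use R in \<open>auto simp: linear_length_def\<close>)
  obtain v z a b where L': "ham_path (grid y {1..<R} (Suc (Suc k))) v z (len_mset y a b ((R - 2) * Suc k + k))"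
    "R - v = 1 \<or> R - v = 3" "v < R" "a + of_bool (R - v = 1) = R - 1" "b + of_bool (R - v = 3) = 1"
    using ham_low_turn_three[OF R(1-3)] by blast
  show "standard (y + c + 1) (len_mset y (y - 1) 1 c)"
    by (rule standard_first_high_low_len_mset[OF H R(5) L'(1), of 1 "R - v", OF _ _ _ _ _ _ c n])
      (use R L' in \<open>auto simp: linear_length_def\<close>)
qed

lemma realization_many_ones:
  assumes "2 \<le> y" "y + 1 \<le> a"
  shows "has_linear_realization (a + b + c + 1) (len_mset y a b c)"
proof (cases "even y \<or> even (c mod y) \<or> c mod y = 1")
  case True
  show ?thesis
    by (rule standard_glue[of "y - 1" 0, OF standard_cong[OF standard_ones_y[OF assms(1) True]]]) (use assms in auto)
next
  case False
  then have odd: "odd y" "odd (c mod y)" "c mod y \<noteq> 1" by auto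
  show ?thesis
  proof (cases "b = 0")
    case True
    show ?thesis
      by (rule standard_glue[of y 0, OF standard_cong[OF standard_ones_y_odd(1)[OF odd]]]) (use assms True in auto)
  next
    case False
    show ?thesis
      by (rule standard_glue[of "y - 1" 1, OF standard_cong[OF standard_ones_y_odd(2)[OF odd]]]) (use assms False in auto)
  qed
qed

section \<open>Multiples of three\<close>

lemma ham_singleton_len_mset: "ham_path {x} x x (len_mset y 0 0 0)"
  using ham_singleton[of x] by (simp add: len_mset_def)

lemma ham_join_len_mset:
  assumes "ham_path V u w (len_mset y a b c)" "ham_path W u' w' (len_mset y a' b' c')" "V \<inter> W = {}" "U = V \<union> W"
    and "{#linear_length w u'#} = len_mset y a'' b'' c''"
    and "A = a + a' + a''" "B = b + b' + b''" "C = c + c' + c''"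
  shows "ham_path U u w' (len_mset y A B C)"
  by (rule ham_join[OF assms(1-4)]) (simp add: assms(5-8) len_mset_add)

text \<open>For \<open>t\<close> odd, \<open>{#1^t, t^c#}\<close> without its first edge, which joins \<open>0\<close> to \<open>t\<close>.\<close>

lemma ham_ones_t_tail:
  assumes "odd t" "odd (q mod t)" "q mod t \<noteq> 1" "t \<le> q"
  shows "\<exists>z. ham_path {1..<Suc q} t z (len_mset t t 0 (q - t - 1))"
proof -
  obtain k' R where R: "even R" "4 \<le> R" "R < t" "q + 1 = t * k' + R" "odd (t - R)" "q mod t + 1 = R"
    "k' = q div t"
    using odd_residue_bounds[OF assms(1-3)] by metis
  have "0 < q div t" using assms(4) R(3) by (simp add: div_greater_zero_iff)
  then obtain k where k: "k' = Suc k" using R(7) not0_implies_Suc by auto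
  have q: "Suc q = t * Suc k + R" using R(4) k by simp
  \<comment> \<open>Column \<open>0\<close> without its lowest vertex is a column of height
    \<open>Suc k\<close> shifted by \<open>t\<close>.\<close>
  let ?F = "grid t {0} (Suc (Suc k)) - {0}"
  have "0 < t" using R(3) by simp
  have "ham_path ?F t (t * Suc k) (len_mset t 0 0 k)"
  proof (rule ham_shift[OF ham_column[of 0 t k, unfolded len_mset_single(5)], of _ t])
    show "?F = (+) t ` grid t {0} (Suc k)"
    proof (intro set_eqI iffI)
      fix x assume x: "x \<in> ?F"
      then have "t \<le> x" using \<open>0 < t\<close> by (auto simp: grid_def intro: dvd_imp_le mod_0_imp_dvd)
      with x show "x \<in> (+) t ` grid t {0} (Suc k)"
        using \<open>0 < t\<close> by (intro image_eqI[of _ _ "x - t"]) (auto simp: grid_def le_mod_geq le_div_geq)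
    qed (use \<open>0 < t\<close> in \<open>auto simp: grid_def\<close>)
  qed (use \<open>0 < t\<close> in auto)
  moreover have "ham_path {R..<t} (t - 1) R (len_mset t (t - R - 1) 0 0)" using R(3) by (rule ham_run_down)
  moreover obtain z where
    "ham_path (grid t {1..<R} (Suc (Suc k))) (R - 1) z (len_mset t (R - 1) 0 ((R - 2) * Suc k + k))"
    using ham_low_turn[OF R(1-3)] by blast
  ultimately have "ham_path {1..<Suc q} t z (len_mset t t 0 (q - t - 1))"
  proof (rule ham_wrap_high_low[OF _ Diff_subset _ R(5)])
    have "{..<R} = {0} \<union> {1..<R}" using R(2) by auto
    then have "grid t {..<R} (Suc (Suc k)) = grid t {0} (Suc (Suc k)) \<union> grid t {1..<R} (Suc (Suc k))"
      by (metis grid_Un)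
    moreover have "0 \<notin> grid t {R..<t} (Suc k)" "0 \<notin> grid t {1..<R} (Suc (Suc k))"
      using R(2) by (auto simp: grid_def)
    moreover have "{1..<Suc q} = {..<Suc q} - {0}" by auto
    ultimately show "{1..<Suc q} = ?F \<union> grid t {R..<t} (Suc k) \<union> grid t {1..<R} (Suc (Suc k))"
      using grid_full[of R t "Suc k"] R(3) \<open>0 < t\<close> unfolding q by auto
    have "{#t - (t - 1)#} = len_mset t 1 0 0" "{#linear_length R (R - 1)#} = len_mset t 1 0 0"
      using R(2,3) by (auto simp: linear_length_def len_mset_def)
    note steps = this
    have q_eq: "q - t - 1 = k + ((R - 2) * Suc k + k) + (t - R) * k"
      using grid_count[of R t k] R(2,3) q by simp
    show "len_mset t t 0 (q - t - 1) = len_mset t 0 0 k + len_mset t (t - R - 1) 0 0 +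
        len_mset t (R - 1) 0 ((R - 2) * Suc k + k) + {#t - (t - 1)#} + {#linear_length R (R - 1)#} +
        replicate_mset ((t - R) * k) t"
      unfolding steps len_mset_single(5) len_mset_add q_eq
      by (rule len_mset_cong) (use R(2,3) in auto)
  qed
  then show ?thesis by blast
qed

text \<open>The even number of short columns is taken leftwards from \<open>t - 1\<close>, then the
  taller ones with the turn in column 1. The start is chosen because \<open>3 * (t - 1) + 2\<close>
  is a neighbour of \<open>3 * t\<close>.\<close>

lemma ham_ones_t_from:
  assumes "odd t" "odd (q mod t)" "q mod t \<noteq> 1" "t \<le> q"
  shows "\<exists>z. ham_path {..<q} (t - 1) z (len_mset t t 0 (q - t - 1))"
proof -
  obtain k' R where R: "even R" "4 \<le> R" "R < t" "q + 1 = t * k' + R" "odd (t - R)" "q mod t + 1 = R"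
    "k' = q div t"
    using odd_residue_bounds[OF assms(1-3)] by metis
  have "0 < q div t" using assms(4) R(3) by (simp add: div_greater_zero_iff)
  then obtain k where k: "k' = Suc k" using R(7) not0_implies_Suc by auto
  define r where "r = R - 1"
  have r: "odd r" "3 \<le> r" "r < t" and q: "q = t * Suc k + r"
    using R k by (auto simp: r_def)
  have "ham_path (grid t {r..<t} (Suc k)) (t - 1) r (len_mset t (t - r - 1) 0 ((t - r) * k))"
    using ham_snake_up[OF ham_run_down[OF r(3), of t] ivl_subset, of k] r(1) assms(1)
    unfolding len_mset_single(5) len_mset_add by simp
  moreover have "\<exists>z. ham_path (grid t {..<r} (Suc (Suc k))) (r - 1) z
      (len_mset t r 0 ((r - 1) * Suc k + k))"
  proof (rule ham_snake_turn)
    show "ham_path {1..<r} (r - 1) 1 (len_mset t (r - 2) 0 0)"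
      using ham_run_down[of 1 r t] r(2) by (simp add: numeral_2_eq_2)
    show "{..<r} = {1..<r} \<union> {0}" using r(2) by auto
    show "1 = linear_length 1 0" by (simp add: linear_length_def)
    have "{#1, 1#} = len_mset t 2 0 0" by (simp add: len_mset_def numeral_2_eq_2)
    moreover have "r = r - 2 + 2" using r(2) by simp
    ultimately show "len_mset t r 0 ((r - 1) * Suc k + k) =
        len_mset t (r - 2) 0 0 + {#1, 1#} + replicate_mset (card {1..<r} * Suc k + k) t"
      by (simp only: len_mset_single(5) len_mset_add card_atLeastLessThan add_0_right add_0)
  qed (use r in auto)
  then obtain z where "ham_path (grid t {..<r} (Suc (Suc k))) (r - 1) z (len_mset t r 0 ((r - 1) * Suc k + k))"
    by blast
  ultimately have "ham_path {..<q} (t - 1) z (len_mset t t 0 (q - t - 1))"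
  proof (rule ham_join)
    show "grid t {r..<t} (Suc k) \<inter> grid t {..<r} (Suc (Suc k)) = {}"
      by (intro grid_disjoint) auto
    show "{..<q} = grid t {r..<t} (Suc k) \<union> grid t {..<r} (Suc (Suc k))"
      unfolding q using r(3) by (subst grid_full) auto
    have step: "{#linear_length r (r - 1)#} = len_mset t 1 0 0"
      using r(2) by (auto simp: linear_length_def len_mset_def)
    have q_eq: "q - t - 1 = (t - r) * k + ((r - 1) * Suc k + k)"
    proof -
      have "t = 1 + (r - 1) + (t - r)" using r by simp
      then have "t * k = (1 + (r - 1) + (t - r)) * k" by (rule arg_cong)
      then have "t * k = k + (r - 1) * k + (t - r) * k" by (simp only: add_mult_distrib mult_1)
      moreover obtain r' where "r = Suc r'" using r(2) by (cases r) auto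
      ultimately show ?thesis using q by simp
    qed
    show "len_mset t t 0 (q - t - 1) = len_mset t (t - r - 1) 0 ((t - r) * k) +
        len_mset t r 0 ((r - 1) * Suc k + k) + {#linear_length r (r - 1)#}"
      unfolding step len_mset_add q_eq by (rule len_mset_cong) (use r(2,3) in auto)
  qed
  then show ?thesis by blast
qed

lemma standard_ones_t:
  assumes "2 \<le> t" "t \<le> b + 1" "t \<le> b \<or> even t \<or> even (c mod t) \<or> c mod t = 1"
  shows "standard (Suc (b + c)) (len_mset t b 0 c)"
proof (cases "even t \<or> even (c mod t) \<or> c mod t = 1")
  case True
  show ?thesis
    by (rule standard_prefix[OF standard_ones_y[OF assms(1) True], of _ "b - (t - 1)"])
      (use assms in \<open>auto simp: len_mset_def simp flip: replicate_mset_plus\<close>)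
next
  case False
  then have "odd t" "odd (c mod t)" "c mod t \<noteq> 1" by auto
  from standard_ones_y_odd(1)[OF this] show ?thesis
    by (rule standard_prefix[of _ _ _ "b - t"])
      (use assms False in \<open>auto simp: len_mset_def simp flip: replicate_mset_plus\<close>)
qed

section \<open>Combining paths on the three residue classes modulo 3\<close>

lemma grid_3_eq: "j < 3 \<Longrightarrow> grid 3 {j} n = (\<lambda>i. 3 * i + j) ` {..<n}"
proof (intro set_eqI iffI)
  fix x assume "j < 3" "x \<in> grid 3 {j} n"
  then show "x \<in> (\<lambda>i. 3 * i + j) ` {..<n}"
    by (intro image_eqI[of _ _ "x div 3"]) (auto simp: grid_def)
qed (auto simp: grid_def)

text \<open>\<open>j\<close> may exceed 2: with \<open>j = 3\<close> the image starts at
  \<open>3\<close>, leaving out the vertex \<open>0\<close>.\<close>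

lemma ham_len_mset_scale:
  assumes "ham_path V u w (len_mset t b 0 c)"
  shows "ham_path ((\<lambda>i. 3 * i + j) ` V) (3 * u + j) (3 * w + j) (len_mset (3 * t) 0 b c)"
  by (rule ham_scale[OF assms]) (simp_all add: len_mset_def)

lemma ham_third:
  assumes "ham_path {..<n} u w (len_mset t b 0 c)" "j < 3"
  shows "ham_path (grid 3 {j} n) (3 * u + j) (3 * w + j) (len_mset (3 * t) 0 b c)"
  using ham_len_mset_scale[OF assms(1), of j] grid_3_eq[OF assms(2)] by simp

text \<open>The copies of one path in the classes 0 and 1 end at the neighbours \<open>3 * w\<close>
  and \<open>3 * w + 1\<close>. The second copy is run backwards to \<open>1\<close>, next to the
  start \<open>2\<close> of the third path.\<close>

lemma standard_thirds:
  assumes "standard m (len_mset t b 0 c)" "standard q (len_mset t b' 0 c')"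
    and "{..<n} = grid 3 {0} m \<union> grid 3 {1} m \<union> grid 3 {2} q"
  shows "standard n (len_mset (3 * t) 2 (2 * b + b') (2 * c + c'))"
proof -
  obtain w z where P: "ham_path {..<m} 0 w (len_mset t b 0 c)" and Q: "ham_path {..<q} 0 z (len_mset t b' 0 c')"
    using assms(1,2) unfolding standard_def by blast
  have step: "{#linear_length (3 * w + 0) (3 * w + 1)#} = len_mset (3 * t) 1 0 0"
    "{#linear_length (3 * 0 + 1) (3 * 0 + 2)#} = len_mset (3 * t) 1 0 0"
    by (simp_all add: linear_length_def len_mset_def)
  have "ham_path (grid 3 {0} m \<union> grid 3 {1} m) (3 * 0 + 0) (3 * 0 + 1) (len_mset (3 * t) 1 (2 * b) (2 * c))"
    by (rule ham_join_len_mset[OF ham_third[OF P] ham_rev[OF ham_third[OF P]] _ refl step(1)])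
      (auto simp: grid_def)
  then have "ham_path {..<n} (3 * 0 + 0) (3 * z + 2) (len_mset (3 * t) 2 (2 * b + b') (2 * c + c'))"
    by (rule ham_join_len_mset[OF _ ham_third[OF Q] _ assms(3) step(2)]) (auto simp: grid_def)
  then show ?thesis unfolding standard_def by auto
qed

text \<open>Class 0 has one vertex more, so \<open>0\<close> is put in front by a step 3. The copy
  starting at \<open>3\<close> then ends next to its twin in class 2.\<close>

lemma standard_thirds_Suc:
  assumes "standard q (len_mset t b 0 c)" "standard q (len_mset t b' 0 c')" "n = 3 * q + 1"
  shows "standard n (len_mset (3 * t) 2 (2 * b + b' + 1) (2 * c + c'))"
proof -
  obtain w z where P: "ham_path {..<q} 0 w (len_mset t b 0 c)" and Q: "ham_path {..<q} 0 z (len_mset t b' 0 c')"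
    using assms(1,2) unfolding standard_def by blast
  have step: "{#linear_length 0 (3 * 0 + 3)#} = len_mset (3 * t) 0 1 0"
    "{#linear_length (3 * w + 3) (3 * w + 2)#} = len_mset (3 * t) 1 0 0"
    "{#linear_length (3 * 0 + 2) (3 * 0 + 1)#} = len_mset (3 * t) 1 0 0"
    by (simp_all add: linear_length_def len_mset_def)
  have class_0: "grid 3 {0} (Suc q) = {0} \<union> (\<lambda>i. 3 * i + 3) ` {..<q}"
    unfolding grid_3_eq[of 0, simplified] lessThan_Suc_eq_insert_0 by (simp add: image_image ac_simps)
  have 1: "ham_path (grid 3 {0} (Suc q)) 0 (3 * w + 3) (len_mset (3 * t) 0 (b + 1) c)"
    by (rule ham_join_len_mset[OF ham_singleton_len_mset ham_len_mset_scale[OF P, of 3] _ class_0 step(1)]) auto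
  have 2: "ham_path (grid 3 {0} (Suc q) \<union> grid 3 {2} q) 0 (3 * 0 + 2)
      (len_mset (3 * t) 1 (2 * b + 1) (2 * c))"
    by (rule ham_join_len_mset[OF 1 ham_rev[OF ham_third[OF P]] _ refl step(2)]) (auto simp: grid_def)
  have U: "{..<n} = grid 3 {0} (Suc q) \<union> grid 3 {2} q \<union> grid 3 {1} q"
    unfolding thirds(2)[OF assms(3)] by blast
  have "ham_path {..<n} 0 (3 * z + 1) (len_mset (3 * t) 2 (2 * b + b' + 1) (2 * c + c'))"
    by (rule ham_join_len_mset[OF 2 ham_third[OF Q] _ U step(3)]) (auto simp: grid_def)
  then show ?thesis unfolding standard_def by blast
qed

text \<open>From \<open>0\<close> step to \<open>1\<close> at once and run through class 1. The rest
  of class 0 follows backwards along the same path without its first edge, so it ends at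
  \<open>3 * t\<close>, from where a third step 1 enters class 2.\<close>

lemma standard_thirds_three_ones:
  assumes "ham_path {1..<Suc q} t w (len_mset t b 0 c)" "ham_path {..<q} (t - 1) z (len_mset t b' 0 c')" "2 \<le> t"
    and "n = 3 * q + 2"
  shows "standard n (len_mset (3 * t) 3 (2 * b + b') (2 * c + c' + 1))"
proof -
  have step: "{#linear_length 0 t#} = len_mset t 0 0 1"
    "{#linear_length 0 (3 * 0 + 1)#} = len_mset (3 * t) 1 0 0"
    "{#linear_length (3 * w + 1) (3 * w + 0)#} = len_mset (3 * t) 1 0 0"
    "{#linear_length (3 * t + 0) (3 * (t - 1) + 2)#} = len_mset (3 * t) 1 0 0"
    using assms(3) by (simp_all add: linear_length_def len_mset_def)
  have "{..<Suc q} = {0} \<union> {1..<Suc q}" by auto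
  then have P: "ham_path {..<Suc q} 0 w (len_mset t b 0 (c + 1))"
    by (intro ham_join_len_mset[OF ham_singleton_len_mset assms(1) _ _ step(1)]) auto
  have 1: "ham_path ({0} \<union> grid 3 {1} (Suc q)) 0 (3 * w + 1) (len_mset (3 * t) 1 b (c + 1))"
    by (rule ham_join_len_mset[OF ham_singleton_len_mset ham_third[OF P] _ refl step(2)])
      (auto simp: grid_def)
  let ?X = "(\<lambda>i. 3 * i + 0) ` {1..<Suc q}"
  have 2: "ham_path ({0} \<union> grid 3 {1} (Suc q) \<union> ?X) 0 (3 * t + 0) (len_mset (3 * t) 2 (2 * b) (2 * c + 1))"
    by (rule ham_join_len_mset[OF 1 ham_rev[OF ham_len_mset_scale[OF assms(1)]] _ refl step(3)])
      (auto simp: grid_def)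
  have "grid 3 {0} (Suc q) = {0} \<union> ?X"
    unfolding grid_3_eq[of 0, simplified] \<open>{..<Suc q} = _\<close> by simp
  then have U: "{..<n} = {0} \<union> grid 3 {1} (Suc q) \<union> ?X \<union> grid 3 {2} q"
    unfolding thirds(3)[OF assms(4)] by blast
  have "ham_path {..<n} 0 (3 * z + 2) (len_mset (3 * t) 3 (2 * b + b') (2 * c + c' + 1))"
    by (rule ham_join_len_mset[OF 2 ham_third[OF assms(2)] _ U step(4)]) (auto simp: grid_def)
  then show ?thesis unfolding standard_def by blast
qed

text \<open>Distributes the threes: \<open>d\<close> for each of the twin paths, \<open>e\<close>
  for the third. Either \<open>d = t\<close> works, or the least \<open>d\<close> with
  \<open>e <= m\<close> does.\<close>

lemma exists_split:
  assumes "3 * t \<le> b" "t < m" "t \<le> M" "b \<le> 2 * M + m"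
  shows "\<exists>d e :: nat. b = 2 * d + e \<and> t \<le> d \<and> d \<le> M \<and> t \<le> e \<and> e \<le> m"
proof (cases "b \<le> 2 * t + m")
  case True
  then show ?thesis using assms by (intro exI[of _ t] exI[of _ "b - 2 * t"]) auto
next
  case False
  define d where "d = (b - m + 1) div 2"
  have "b - m \<le> 2 * d" "2 * d \<le> b - m + 1" unfolding d_def by presburger+
  then show ?thesis using assms False
    by (intro exI[of _ d] exI[of _ "b - 2 * d"]) auto
qed

lemma realization_multiple_of_three:
  assumes "2 \<le> t" "2 \<le> a" "3 * t \<le> b" "1 \<le> c"
    and "b = 3 * t \<Longrightarrow> (b + c) mod 3 = 1 \<Longrightarrow> 3 \<le> a"
  shows "has_linear_realization (a + b + c + 1) (len_mset (3 * t) a b c)"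
proof -
  \<comment> \<open>The standard path uses all threes and all lengths \<open>3 * t\<close>, so the
    rest consists of ones.\<close>
  have *: ?thesis if "standard (a' + b + c + 1) (len_mset (3 * t) a' b c)" "a' \<le> a" for a'
    by (rule standard_glue[of a' b]) (use that in auto)
  have S: "standard (Suc m) (len_mset t d 0 (m - d))" if "t \<le> d" "d \<le> m" for d m
    using standard_ones_t[of t d "m - d"] that assms(1) by simp
  define m where "m = (b + c) div 3"
  \<comment> \<open>A standard path with two ones has \<open>b + c + 3\<close> vertices, so
    \<open>b + c\<close> modulo 3 tells which classes are larger. The condition \<open>t < m\<close>
    is what \<open>exists_split\<close> requires.\<close>
  consider "b + c = 3 * m" | "b + c = 3 * m + 1" "3 * t + 1 \<le> b" | "b + c = 3 * m + 1" "b = 3 * t"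
    | "b + c = 3 * m + 2" "t < m" | "b + c = 3 * m + 2" "m \<le> t"
    unfolding m_def using assms(3) by linarith
  then show ?thesis
  proof cases
    case 1
    then obtain d e where "b = 2 * d + e" "t \<le> d" "d \<le> m" "t \<le> e" "e \<le> m"
      using exists_split[of t b m m] assms(3,4) by auto
    moreover from this have "standard (b + c + 3) (len_mset (3 * t) 2 (2 * d + e) (2 * (m - d) + (m - e)))"
      by (intro standard_thirds[OF S S] thirds(1)) (use 1 in auto)
    ultimately show ?thesis using 1 assms(2) by (intro *[of 2]) (auto elim!: standard_cong intro!: len_mset_cong)
  next
    case 2
    then have "\<exists>d e. b - 1 = 2 * d + e \<and> t \<le> d \<and> d \<le> m \<and> t \<le> e \<and> e \<le> m"
      using assms(4) by (intro exists_split) auto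
    then obtain d e where "b - 1 = 2 * d + e" "t \<le> d" "d \<le> m" "t \<le> e" "e \<le> m" by blast
    moreover from this
    have "standard (b + c + 3) (len_mset (3 * t) 2 (2 * d + e + 1) (2 * (m - d) + (m - e)))"
      by (intro standard_thirds_Suc[OF S S]) (use 2 in auto)
    ultimately show ?thesis using 2 assms(2)
      by (intro *[of 2]) (auto elim!: standard_cong intro!: len_mset_cong)
  next
    case 3
    then have "t \<le> m" "3 \<le> a" using assms(4,5) by auto
    define q where "q = Suc m"
    show ?thesis
    \<comment> \<open>After the extra step 3 only \<open>3 * t - 1\<close> threes are left, so one
      class has to manage with \<open>t - 1\<close>. If the parities forbid this, each class takes
      \<open>t\<close> and a third one is spent.\<close>
    proof (cases "even t \<or> even (q mod t) \<or> q mod t = 1")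
      case True
      have "(q - t) mod t = q mod t" using le_mod_geq[of t q] \<open>t \<le> m\<close> by (simp add: q_def)
      then have "standard (Suc (t - 1 + (q - t))) (len_mset t (t - 1) 0 (q - t))"
        using True assms(1) by (intro standard_ones_t) auto
      then have "standard q (len_mset t (t - 1) 0 (q - t))"
        by (rule standard_cong) (use \<open>t \<le> m\<close> assms(1) in \<open>auto simp: q_def\<close>)
      from standard_thirds_Suc[OF S[OF le_refl \<open>t \<le> m\<close>, folded q_def] this refl]
      have "standard (3 * q + 1) (len_mset (3 * t) 2 (2 * t + (t - 1) + 1) (2 * (m - t) + (q - t)))" .
      then have "standard (2 + b + c + 1) (len_mset (3 * t) 2 b c)"
        by (rule standard_cong) (use 3 \<open>t \<le> m\<close> assms(1) in \<open>auto simp: q_def intro!: len_mset_cong\<close>)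
      then show ?thesis using assms(2) by (intro *[of 2])
    next
      case False
      then have "odd t" "odd (q mod t)" "q mod t \<noteq> 1" "t \<le> q"
        using \<open>t \<le> m\<close> by (auto simp: q_def)
      then obtain w z where "ham_path {1..<Suc q} t w (len_mset t t 0 (q - t - 1))"
        "ham_path {..<q} (t - 1) z (len_mset t t 0 (q - t - 1))"
        using ham_ones_t_tail ham_ones_t_from by metis
      from standard_thirds_three_ones[OF this assms(1) refl]
      have "standard (3 + b + c + 1) (len_mset (3 * t) 3 b c)"
        by (rule standard_cong) (use 3 \<open>t \<le> m\<close> in \<open>auto simp: q_def intro!: len_mset_cong\<close>)
      then show ?thesis using \<open>3 \<le> a\<close> by (intro *[of 3])
    qed
  next
    case 4
    then obtain d e where "b = 2 * d + e" "t \<le> d" "d \<le> m + 1" "t \<le> e" "e \<le> m"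
      using exists_split[of t b m "m + 1"] assms(3,4) by auto
    moreover from this have "standard (b + c + 3) (len_mset (3 * t) 2 (2 * d + e) (2 * (Suc m - d) + (m - e)))"
      by (intro standard_thirds[OF S[of d "Suc m"] S[of e m] thirds(3)]) (use 4 in auto)
    ultimately show ?thesis using 4 assms(2) by (intro *[of 2]) (auto elim!: standard_cong intro!: len_mset_cong)
  next
    case 5
    \<comment> \<open>Since \<open>3 * t <= b\<close> and \<open>1 <= c\<close>, only two pairs of
      \<open>b\<close> and \<open>c\<close> remain. They are distributed by hand, as
      \<open>t, t, t\<close> and \<open>t + 1, t + 1, t - 1\<close>.\<close>
    then have "m = t" "b = 3 * t \<or> b = 3 * t + 1 \<and> c = 1" using assms(3,4) by auto
    then consider "m = t" "b = 3 * t" "c = 2" | "m = t" "b = 3 * t + 1" "c = 1" using 5 by auto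
    then show ?thesis
    proof cases
      case 1
      have "standard (b + c + 3) (len_mset (3 * t) 2 (2 * t + t) (2 * (Suc m - t) + (m - t)))"
        by (intro standard_thirds[OF S[of t "Suc m"] S[of t m] thirds(3)]) (use 1 5 in auto)
      then show ?thesis using 1 assms(2) by (intro *[of 2]) (auto elim!: standard_cong intro!: len_mset_cong)
    next
      case 2
      have "1 mod t = 1" using assms(1) by simp
      then have "standard (Suc (t - 1 + 1)) (len_mset t (t - 1) 0 1)"
        using assms(1) by (intro standard_ones_t) auto
      then have "standard (b + c + 3) (len_mset (3 * t) 2 (2 * (t + 1) + (t - 1)) (2 * (Suc m - (t + 1)) + 1))"
        by (intro standard_thirds[OF S[of "t + 1" "Suc m"] _ thirds(3)[of _ "Suc m"]]) (use 2 5 assms(1) in auto)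
      then show ?thesis using 2 assms(1,2)
        by (intro *[of 2]) (auto elim!: standard_cong intro!: len_mset_cong)
    qed
  qed
qed

theorem theorem5p1:
  fixes y a b c v q r :: nat and L :: "nat multiset"
  assumes "y > 3"
    and "L = replicate_mset a 1 + replicate_mset b 3 + replicate_mset c y"
    and "v = a + b + c + 1"
    and "admissible v L"
    and "v = 3 * q + r" and "r < 3"
    and "a \<ge> y + 1
       \<or> (a \<ge> 7 \<and> b \<ge> y - 4)
       \<or> (a \<ge> 4 \<and> a + b \<ge> y + 1 \<and> (c mod y = 0 \<or> c mod y = 1))
       \<or> (a \<ge> 2 \<and> (\<exists>t. y = 3 * t \<and> v \<ge> 3 * t + 6 \<and>
            ((even r \<and> b \<ge> 3 * t) \<or> (odd r \<and> b \<ge> 3 * t + 1))))"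
  shows "has_linear_realization v L"
proof -
  have L: "L = len_mset y a b c" using assms(2) by (simp add: len_mset_def)
  from assms(7) consider "y + 1 \<le> a" | "7 \<le> a" "y - 4 \<le> b"
    | "4 \<le> a" "y + 1 \<le> a + b" "c mod y = 0 \<or> c mod y = 1"
    | t where "2 \<le> a" "y = 3 * t" "3 * t \<le> b" "odd r \<Longrightarrow> 3 * t + 1 \<le> b"
    by (elim disjE conjE exE) (blast dest: add_leD1)+
  then show ?thesis
  proof cases
    case 1
    then show ?thesis
      unfolding L assms(3) using assms(1) by (intro realization_many_ones) auto
  next
    case 2
    show ?thesis
    proof (cases "y + 1 \<le> a")
      case True
      then show ?thesis
        unfolding L assms(3) using assms(1) by (intro realization_many_ones) auto
    next
      \<comment> \<open>Now \<open>a <= y\<close>, so \<open>7 <= a\<close> yields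
        \<open>7 <= y\<close>.\<close>
      case False
      then show ?thesis
        unfolding L assms(3) using 2 by (intro realization_many_threes) auto
    qed
  next
    case 3
    then show ?thesis
      unfolding L assms(3) using assms(1) by (intro realization_residue_0_or_1) auto
  next
    case (4 t)
    show ?thesis
    proof (cases "c = 0")
      case True
      have "standard v L"
        using standard_ones_threes[of a b y] 4(1) True unfolding L assms(3) by simp
      then show ?thesis by (rule standard_imp_realization)
    next
      case False
      \<comment> \<open>If \<open>a = 2\<close>, then \<open>v = b + c + 3\<close> and
        \<open>r = 1\<close> is odd, which forces \<open>b >= 3 * t + 1\<close>.\<close>
      have "3 \<le> a" if "b = 3 * t" "(b + c) mod 3 = 1"
      proof (rule ccontr)
        assume "\<not> 3 \<le> a"
        then have "3 * q + r = b + c + 3" using 4(1) assms(3,5) by simp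
        then have "r = 1" using that(2) assms(6) by presburger
        then show False using 4(4) that(1) by simp
      qed
      then show ?thesis
        unfolding L assms(3) 4(2) using assms(1) 4 False
        by (intro realization_multiple_of_three) auto
    qed
  qed
qed

end
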